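(* Let $x\in 2^\omega$ be a real with effective Hausdorff dimension $\dim^1_H(x)>0$. Then $x$ computes an infinite subset of a Martin-Löf random set of integers; in fact, there exist a Martin-Löf random set $R\subseteq\omega$ and an infinite set $Y\subseteq R$ such that $x$ is truth-table equivalent to $Y$.
   Context: $\omega=\{0,1,2,\dots\}$; subsets of $\omega$ are identified with their characteristic functions in $2^\omega$. For a finite binary string $\sigma$, $[\sigma]\subseteq 2^\omega$ is the set of infinite extensions of $\sigma$, and for a set of strings $V$, $[V]^\preceq=\bigcup_{\sigma\in V}[\sigma]$. For a real number $0\le\gamma\le 1$, the $\gamma$-weight of a set $C$ of binary strings is $\mathrm{wt}_\gamma(C)=\sum_{w\in C}2^{-|w|\gamma}$. A Martin-Löf $\gamma$-test is a uniformly computably enumerable sequence $(U_n)_{n<\omega}$ of sets of binary strings with $\mathrm{wt}_\gamma(U_n)\le 2^{-n}$ for all $n$. A real $x$ is $\gamma$-random if $x\notin\bigcap_n[U_n]^\preceq$ for every Martin-Löf $\gamma$-test $(U_n)_{n<\omega}$. If $\gamma=1$, the real $x$, or the set of integers $\{n:x(n)=1\}$, is called Martin-Löf random. The effective Hausdorff dimension of $x$ is $\dim^1_H(x)=\sup\{\gamma\in[0,1]:x\text{ is }\gamma\text{-random}\}$. *)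

theory Defs
  imports "HOL-Analysis.Analysis" "HOL-Library.Nat_Bijection"
begin

section \<open>Partial recursive functions relative to a real\<close>

text \<open>Programs denote partial functions on argument lists, without a fixed arity:
  \<open>Zero\<close> accepts any list, \<open>Proj i\<close> any list longer than \<open>i\<close>, and the result is
  undefined whenever no rule applies. Recursion and search act on the first argument.\<close>

datatype prog =
    Zero
  | Succ
  | Proj nat
  | Query
  | Comp prog "prog list"
  | PrimRec prog prog
  | Mu prog

inductive run :: "(nat \<Rightarrow> bool) \<Rightarrow> prog \<Rightarrow> nat list \<Rightarrow> nat \<Rightarrow> bool" for x where
  Zero: "run x Zero ns 0"
| Succ: "run x Succ [n] (Suc n)"
| Proj: "i < length ns \<Longrightarrow> run x (Proj i) ns (ns ! i)"
| Query: "run x Query [n] (of_bool (x n))"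
| Comp: "length ms = length gs \<Longrightarrow> (\<And>i. i < length gs \<Longrightarrow> run x (gs ! i) ns (ms ! i)) \<Longrightarrow>
    run x f ms r \<Longrightarrow> run x (Comp f gs) ns r"
| PrimRec_0: "run x f ns r \<Longrightarrow> run x (PrimRec f g) (0 # ns) r"
| PrimRec_Suc: "run x (PrimRec f g) (k # ns) r \<Longrightarrow> run x g (k # r # ns) s \<Longrightarrow>
    run x (PrimRec f g) (Suc k # ns) s"
| Mu: "run x f (k # ns) 0 \<Longrightarrow> (\<And>i. i < k \<Longrightarrow> run x f (i # ns) (Suc (h i))) \<Longrightarrow>
    run x (Mu f) ns k"

definition turing_reducible :: "(nat \<Rightarrow> bool) \<Rightarrow> (nat \<Rightarrow> bool) \<Rightarrow> bool"  (infix "\<le>\<^sub>T" 50) where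
  "y \<le>\<^sub>T x \<longleftrightarrow> (\<exists>p. \<forall>n. run x p [n] (of_bool (y n)))"

text \<open>Absolute computability is computability relative to the empty set.\<close>

definition computable :: "(nat \<Rightarrow> nat) \<Rightarrow> bool" where
  "computable f \<longleftrightarrow> (\<exists>p. \<forall>n. run (\<lambda>_. False) p [n] (f n))"

definition string_code :: "bool list \<Rightarrow> nat" where
  "string_code w = list_encode (map of_bool w)"

definition uniformly_ce :: "(nat \<Rightarrow> bool list set) \<Rightarrow> bool" where
  "uniformly_ce U \<longleftrightarrow>
     (\<exists>p. \<forall>n w. w \<in> U n \<longleftrightarrow> (\<exists>r. run (\<lambda>_. False) p [n, string_code w] r))"


section \<open>Truth-table reducibility\<close>

text \<open>A truth-table condition is a finite list of query positions together with a Boolean function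
  of the answers. Every number codes one: the first component lists the positions, and the second
  lists the (codes of the) answer vectors on which the Boolean function is true.\<close>

definition tt_satisfies :: "(nat \<Rightarrow> bool) \<Rightarrow> nat \<Rightarrow> bool" where
  "tt_satisfies x c \<longleftrightarrow>
     (case prod_decode c of (q, t) \<Rightarrow>
        string_code (map x (list_decode q)) \<in> set (list_decode t))"

definition tt_reducible :: "(nat \<Rightarrow> bool) \<Rightarrow> (nat \<Rightarrow> bool) \<Rightarrow> bool"  (infix "\<le>\<^sub>t\<^sub>t" 50) where
  "y \<le>\<^sub>t\<^sub>t x \<longleftrightarrow> (\<exists>f. computable f \<and> (\<forall>n. y n \<longleftrightarrow> tt_satisfies x (f n)))"

definition tt_equivalent :: "(nat \<Rightarrow> bool) \<Rightarrow> (nat \<Rightarrow> bool) \<Rightarrow> bool"  (infix "\<equiv>\<^sub>t\<^sub>t" 50) where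
  "x \<equiv>\<^sub>t\<^sub>t y \<longleftrightarrow> x \<le>\<^sub>t\<^sub>t y \<and> y \<le>\<^sub>t\<^sub>t x"


section \<open>Randomness and effective Hausdorff dimension\<close>

definition cylinder :: "bool list \<Rightarrow> (nat \<Rightarrow> bool) set" where
  "cylinder w = {x. \<forall>i < length w. x i = w ! i}"

definition open_of :: "bool list set \<Rightarrow> (nat \<Rightarrow> bool) set" where
  "open_of V = (\<Union>w\<in>V. cylinder w)"

text \<open>The weight takes values in the extended non-negative reals, so that a divergent sum is
  infinite instead of defaulting to 0.\<close>

definition wt :: "real \<Rightarrow> bool list set \<Rightarrow> ennreal" where
  "wt \<gamma> C = (\<Sum>\<^sub>\<infinity>w\<in>C. ennreal (2 powr (- (real (length w) * \<gamma>))))"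

definition ml_test :: "real \<Rightarrow> (nat \<Rightarrow> bool list set) \<Rightarrow> bool" where
  "ml_test \<gamma> U \<longleftrightarrow> uniformly_ce U \<and> (\<forall>n. wt \<gamma> (U n) \<le> ennreal (1 / 2 ^ n))"

definition gamma_random :: "real \<Rightarrow> (nat \<Rightarrow> bool) \<Rightarrow> bool" where
  "gamma_random \<gamma> x \<longleftrightarrow> (\<forall>U. ml_test \<gamma> U \<longrightarrow> x \<notin> (\<Inter>n. open_of (U n)))"

definition ml_random :: "(nat \<Rightarrow> bool) \<Rightarrow> bool" where
  "ml_random x \<longleftrightarrow> gamma_random 1 x"

definition effective_dim :: "(nat \<Rightarrow> bool) \<Rightarrow> real" where
  "effective_dim x = Sup {\<gamma>. 0 \<le> \<gamma> \<and> \<gamma> \<le> 1 \<and> gamma_random \<gamma> x}"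

end

theory Submission
  imports Defs "HOL-Probability.Probability"
begin

text \<open>Choose \<open>k\<close> with \<open>3 \<le> k * \<gamma>\<close> for some \<open>\<gamma> > 0\<close> such that \<open>x\<close> is \<open>\<gamma>\<close>-random, and let \<open>Y\<close> be the set
  of codes of the initial segments of \<open>x\<close> whose length is a multiple of \<open>k\<close>; it is truth-table
  equivalent to \<open>x\<close>. Adding \<open>Y\<close> to a set \<open>B\<close> chosen by fair coin tosses yields a Martin-Loef random
  superset of \<open>Y\<close> with probability one. As there are only countably many tests, it suffices to
  consider one test \<open>U\<close>. Suppose that \<open>Y \<union> B\<close> fails it with probability more than \<open>2 ^ (- d)\<close>. For each
  \<open>n\<close>, consider the strings \<open>\<sigma>\<close> for which the initial segments of \<open>\<sigma>\<close> together with \<open>B\<close> fall into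
  \<open>U n\<close> with such a probability, and enumerate them, putting mass \<open>4 ^ (- l)\<close> on each of length \<open>k * l\<close> as
  long as no prefix of length \<open>k * j\<close> carries mass \<open>4 ^ (- j)\<close> already. The second moment method for
  percolation on the tree of strings bounds the total mass by a constant times \<open>2 ^ (- n)\<close>, and the
  strings carrying their full mass \<open>4 ^ (- j)\<close>, which are c.e. and at each level have weight at most
  the total mass, form a \<open>\<gamma>\<close>-test that captures \<open>x\<close>.\<close>

section \<open>Computability relative to an oracle\<close>

text \<open>Programs have no fixed arity, so only lists of length \<open>k\<close> are constrained.
  This layer serves to bootstrap pairing and basic arithmetic; from then on several arguments travel
  as one coded number.\<close>

definition list_recursive_in :: "(nat \<Rightarrow> bool) \<Rightarrow> nat \<Rightarrow> (nat list \<Rightarrow> nat) \<Rightarrow> bool" where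
  "list_recursive_in x k f \<longleftrightarrow> (\<exists>p. \<forall>ns. length ns = k \<longrightarrow> run x p ns (f ns))"

lemma listrec_cong: "list_recursive_in x k f \<Longrightarrow> (\<And>ns. length ns = k \<Longrightarrow> f ns = g ns) \<Longrightarrow> list_recursive_in x k g"
  unfolding list_recursive_in_def by metis

lemma listrec_zero: "list_recursive_in x k (\<lambda>_. 0)"
  unfolding list_recursive_in_def by (blast intro: run.Zero)

lemma listrec_nth: "i < k \<Longrightarrow> list_recursive_in x k (\<lambda>ns. ns ! i)"
  unfolding list_recursive_in_def by (blast intro: run.Proj)

lemma run_comp1:
  "run x q ns r \<Longrightarrow> run x p [r] s \<Longrightarrow> run x (Comp p [q]) ns s"
  by (rule run.Comp[where ms = "[r]"]) (auto simp: less_Suc_eq)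

lemma run_comp2:
  "run x q ns r \<Longrightarrow> run x q' ns r' \<Longrightarrow> run x p [r, r'] s \<Longrightarrow> run x (Comp p [q, q']) ns s"
  by (rule run.Comp[where ms = "[r, r']"]) (auto simp: less_Suc_eq)

lemma listrec_comp1:
  assumes "list_recursive_in x 1 (\<lambda>ns. f (ns ! 0))" "list_recursive_in x k g"
  shows "list_recursive_in x k (\<lambda>ns. f (g ns))"
proof -
  obtain p q where p: "\<And>ns. length ns = 1 \<Longrightarrow> run x p ns (f (ns ! 0))"
    and q: "\<And>ns. length ns = k \<Longrightarrow> run x q ns (g ns)"
    using assms unfolding list_recursive_in_def by metis
  have "run x (Comp p [q]) ns (f (g ns))" if "length ns = k" for ns
    using run_comp1[OF q[OF that]] p[of "[g ns]"] by simp
  then show ?thesis unfolding list_recursive_in_def by blast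
qed

lemma listrec_comp2:
  assumes "list_recursive_in x 2 (\<lambda>ns. f (ns ! 0) (ns ! 1))" "list_recursive_in x k g" "list_recursive_in x k h"
  shows "list_recursive_in x k (\<lambda>ns. f (g ns) (h ns))"
proof -
  obtain p q r where p: "\<And>ns. length ns = 2 \<Longrightarrow> run x p ns (f (ns ! 0) (ns ! 1))"
    and q: "\<And>ns. length ns = k \<Longrightarrow> run x q ns (g ns)"
    and r: "\<And>ns. length ns = k \<Longrightarrow> run x r ns (h ns)"
    using assms unfolding list_recursive_in_def by metis
  have "run x (Comp p [q, r]) ns (f (g ns) (h ns))" if "length ns = k" for ns
    using run_comp2[OF q[OF that] r[OF that]] p[of "[g ns, h ns]"] by simp
  then show ?thesis unfolding list_recursive_in_def by blast
qed

lemma listrec_Suc: "list_recursive_in x k f \<Longrightarrow> list_recursive_in x k (\<lambda>ns. Suc (f ns))"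
proof (rule listrec_comp1[where f = Suc])
  have "run x Succ ns (Suc (ns ! 0))" if "length ns = 1" for ns
    using that run.Succ[of x "ns ! 0"] by (cases ns) auto
  then show "list_recursive_in x 1 (\<lambda>ns. Suc (ns ! 0))" unfolding list_recursive_in_def by blast
qed

lemma run_PrimRec:
  assumes "run x p ns a" "\<And>i r. run x q (i # r # ns) (h i r)"
  shows "run x (PrimRec p q) (n # ns) (rec_nat a h n)"
proof (induction n)
  case 0
  show ?case using assms(1) by (auto intro: run.PrimRec_0)
next
  case (Suc n)
  then show ?case using run.PrimRec_Suc[OF Suc assms(2)] by simp
qed

lemma listrec_rec:
  assumes "list_recursive_in x k a" "list_recursive_in x (Suc (Suc k)) (\<lambda>ns. h (ns ! 0) (ns ! 1) (tl (tl ns)))"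
  shows "list_recursive_in x (Suc k) (\<lambda>ns. rec_nat (a (tl ns)) (\<lambda>i r. h i r (tl ns)) (ns ! 0))"
proof -
  obtain p q where p: "\<And>ns. length ns = k \<Longrightarrow> run x p ns (a ns)"
    and q: "\<And>ns. length ns = Suc (Suc k) \<Longrightarrow> run x q ns (h (ns ! 0) (ns ! 1) (tl (tl ns)))"
    using assms unfolding list_recursive_in_def by metis
  have "run x (PrimRec p q) ns (rec_nat (a (tl ns)) (\<lambda>i r. h i r (tl ns)) (ns ! 0))"
    if "length ns = Suc k" for ns
  proof -
    obtain n ms where ns: "ns = n # ms" "length ms = k" using \<open>length ns = Suc k\<close> by (cases ns) auto
    show ?thesis unfolding ns
      using run_PrimRec[of x p ms "a ms" q "\<lambda>i r. h i r ms" n] p[OF ns(2)]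
        q[of "i # r # ms" for i r] ns(2) by simp
  qed
  then show ?thesis unfolding list_recursive_in_def by blast
qed

lemma listrec_add: "list_recursive_in x 2 (\<lambda>ns. ns ! 0 + ns ! 1)"
proof -
  have "list_recursive_in x (Suc 1) (\<lambda>ns. rec_nat (tl ns ! 0) (\<lambda>i r. Suc r) (ns ! 0))"
    by (rule listrec_rec[where h = "\<lambda>i r ns. Suc r"]) (auto intro!: listrec_Suc listrec_nth)
  moreover have *: "rec_nat b (\<lambda>i r. Suc r) n = n + b" for n b :: nat
    by (induction n) auto
  ultimately have "list_recursive_in x 2 (\<lambda>ns. ns ! 0 + tl ns ! 0)" unfolding * by (simp add: numeral_2_eq_2)
  then show ?thesis by (rule listrec_cong) (simp add: nth_tl)
qed

lemmas listrec_add' = listrec_comp2[where f = "(+)", OF listrec_add]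

lemma listrec_pred: "list_recursive_in x 1 (\<lambda>ns. ns ! 0 - 1)"
proof -
  have "list_recursive_in x (Suc 0) (\<lambda>ns. rec_nat 0 (\<lambda>i r. i) (ns ! 0))"
    by (rule listrec_rec[where h = "\<lambda>i r ns. i"]) (auto intro!: listrec_zero listrec_nth)
  moreover have "rec_nat 0 (\<lambda>i r. i) n = n - 1" for n
    by (induction n) auto
  ultimately show ?thesis by simp
qed

lemma listrec_diff: "list_recursive_in x 2 (\<lambda>ns. ns ! 0 - ns ! 1)"
proof -
  have "list_recursive_in x (Suc 1) (\<lambda>ns. rec_nat (tl ns ! 0) (\<lambda>i r. r - 1) (ns ! 0))"
    by (rule listrec_rec[where h = "\<lambda>i r ns. r - 1"])
      (rule listrec_nth listrec_comp1[where f = "\<lambda>r. r - 1", OF listrec_pred] | simp)+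
  moreover have *: "rec_nat b (\<lambda>i r. r - 1) n = b - n" for n b :: nat
    by (induction n) auto
  ultimately have "list_recursive_in x 2 (\<lambda>ns. tl ns ! 0 - ns ! 0)" unfolding * by (simp add: numeral_2_eq_2)
  then have *: "list_recursive_in x 2 (\<lambda>ns. ns ! 1 - ns ! 0)" by (rule listrec_cong) (simp add: nth_tl)
  \<comment> \<open>The recursion runs on the subtrahend, which therefore comes first; the arguments
    are swapped back here.\<close>
  show ?thesis
    by (rule listrec_comp2[where f = "\<lambda>a b. b - a", OF *]) (auto intro: listrec_nth)
qed

lemmas listrec_diff' = listrec_comp2[where f = "(-)", OF listrec_diff]

section \<open>The pairing function and its inverse\<close>

lemma listrec_triangle: "list_recursive_in x 1 (\<lambda>ns. triangle (ns ! 0))"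
proof -
  have "list_recursive_in x (Suc 0) (\<lambda>ns. rec_nat 0 (\<lambda>i r. r + Suc i) (ns ! 0))"
    by (rule listrec_rec[where h = "\<lambda>i r ns. r + Suc i"])
      (auto simp del: add_Suc_right intro!: listrec_add' listrec_Suc listrec_zero listrec_nth)
  moreover have "rec_nat 0 (\<lambda>i r. r + Suc i) n = triangle n" for n
    by (induction n) auto
  ultimately show ?thesis by simp
qed

lemmas listrec_triangle' = listrec_comp1[where f = triangle, OF listrec_triangle]

lemma listrec_prod_encode: "list_recursive_in x 2 (\<lambda>ns. prod_encode (ns ! 0, ns ! 1))"
  unfolding prod_encode_def split by (intro listrec_add' listrec_triangle' listrec_nth) auto

text \<open>The largest \<open>r\<close> with \<open>triangle r \<le> n\<close>, by primitive
  recursion: the truncated difference is \<open>1\<close> exactly when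
  \<open>triangle (Suc r) \<le> Suc i\<close>, and \<open>0\<close> otherwise.\<close>

definition triangle_root :: "nat \<Rightarrow> nat" where
  "triangle_root = rec_nat 0 (\<lambda>i r. r + (1 - (triangle (Suc r) - Suc i)))"

lemma triangle_root_bounds: "triangle (triangle_root n) \<le> n \<and> n < triangle (Suc (triangle_root n))"
proof (induction n)
  case 0
  then show ?case by (simp add: triangle_root_def)
next
  case (Suc n)
  have step: "triangle_root (Suc n) =
      triangle_root n + (1 - (triangle (Suc (triangle_root n)) - Suc n))"
    by (simp add: triangle_root_def)
  show ?case
  proof (cases "triangle (Suc (triangle_root n)) \<le> Suc n")
    case True
    then have "triangle (Suc (triangle_root n)) = Suc n" using Suc by linarith
    moreover have "triangle_root (Suc n) = Suc (triangle_root n)" using True step by simp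
    ultimately show ?thesis by simp
  next
    case False
    then have "triangle_root (Suc n) = triangle_root n" using step by simp
    then show ?thesis using False Suc by simp
  qed
qed

lemma triangle_mono: "m \<le> n \<Longrightarrow> triangle m \<le> triangle n"
  by (induction n rule: dec_induct) auto

lemma triangle_root_eq: "triangle r \<le> n \<Longrightarrow> n < triangle (Suc r) \<Longrightarrow> triangle_root n = r"
  using triangle_root_bounds[of n] triangle_mono[of "Suc r" "triangle_root n"]
    triangle_mono[of "Suc (triangle_root n)" r]
  by (cases r "triangle_root n" rule: linorder_cases) auto

text \<open>As \<open>prod_encode (a, b) = triangle (a + b) + a\<close>, the sum
  \<open>a + b\<close> is the triangular root of the code. This closed form makes both projections
  primitive recursive.\<close>

lemma prod_decode_triangle_root:
  "prod_decode n = (n - triangle (triangle_root n), triangle_root n - (n - triangle (triangle_root n)))"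
proof -
  obtain a b where ab: "prod_decode n = (a, b)" by fastforce
  have "n = prod_encode (a, b)" using prod_decode_inverse[of n] ab by simp
  then have n: "n = triangle (a + b) + a" by (simp add: prod_encode_def)
  then have "triangle_root n = a + b" by (intro triangle_root_eq) auto
  then show ?thesis using ab n by simp
qed

lemma listrec_triangle_root: "list_recursive_in x 1 (\<lambda>ns. triangle_root (ns ! 0))"
proof -
  have "list_recursive_in x (Suc 0) (\<lambda>ns. rec_nat 0 (\<lambda>i r. r + (Suc 0 - (triangle (Suc r) - Suc i))) (ns ! 0))"
    by (rule listrec_rec[where h = "\<lambda>i r ns. r + (Suc 0 - (triangle (Suc r) - Suc i))"])
      (auto simp del: triangle_Suc intro!: listrec_add' listrec_diff' listrec_Suc listrec_triangle' listrec_zero listrec_nth)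
  then show ?thesis by (simp add: triangle_root_def)
qed

lemmas listrec_triangle_root' = listrec_comp1[where f = triangle_root, OF listrec_triangle_root]

lemma listrec_fst: "list_recursive_in x 1 (\<lambda>ns. fst (prod_decode (ns ! 0)))"
  unfolding prod_decode_triangle_root fst_conv
  by (intro listrec_diff' listrec_triangle' listrec_triangle_root' listrec_nth) simp_all

lemma listrec_snd: "list_recursive_in x 1 (\<lambda>ns. snd (prod_decode (ns ! 0)))"
  unfolding prod_decode_triangle_root snd_conv
  by (intro listrec_diff' listrec_triangle' listrec_triangle_root' listrec_nth) simp_all

section \<open>Recursive functions between encoded types\<close>

class enc =
  fixes enc :: "'a \<Rightarrow> nat"

instantiation nat :: enc
begin
definition enc_nat :: "nat \<Rightarrow> nat" where [simp]: "enc_nat n = n"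
instance ..
end

instantiation bool :: enc
begin
definition enc_bool :: "bool \<Rightarrow> nat" where [simp]: "enc_bool b = of_bool b"
instance ..
end

instantiation prod :: (enc, enc) enc
begin
definition enc_prod :: "'a \<times> 'b \<Rightarrow> nat" where [simp]: "enc_prod p = prod_encode (enc (fst p), enc (snd p))"
instance ..
end

instantiation list :: (enc) enc
begin
definition enc_list :: "'a list \<Rightarrow> nat" where [simp]: "enc_list l = list_encode (map enc l)"
instance ..
end

text \<open>All functions are unary, with several arguments packed into a nested pair
  \<open>e\<close>. Closure properties then become introduction rules for terms of the form
  \<open>\<lambda>e. ...\<close>, and a function is shown recursive by following the syntax of its
  defining term.\<close>

definition recursive_in :: "(nat \<Rightarrow> bool) \<Rightarrow> ('a::enc \<Rightarrow> 'b::enc) \<Rightarrow> bool" where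
  "recursive_in x f \<longleftrightarrow> (\<exists>p. \<forall>a. run x p [enc a] (enc (f a)))"

lemma recin_if_listrec:
  assumes "list_recursive_in x 1 (\<lambda>ns. F (ns ! 0))" "\<And>a. F (enc a) = enc (f a)"
  shows "recursive_in x f"
proof -
  obtain p where "\<And>ns. length ns = 1 \<Longrightarrow> run x p ns (F (ns ! 0))"
    using assms unfolding list_recursive_in_def by metis
  then have "run x p [enc a] (enc (f a))" for a using assms(2)[of a] by (metis length_Cons list.size(3) nth_Cons_0 One_nat_def)
  then show ?thesis unfolding recursive_in_def by blast
qed

lemma recin_comp: "recursive_in x f \<Longrightarrow> recursive_in x g \<Longrightarrow> recursive_in x (\<lambda>e. f (g e))"
  unfolding recursive_in_def using run_comp1 by meson

lemma recin_id: "recursive_in x (\<lambda>e. e)"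
  by (rule recin_if_listrec[where F = "\<lambda>n. n"]) (auto intro: listrec_nth)

lemma listrec_const: "list_recursive_in x k (\<lambda>_. n)"
  by (induction n) (auto intro: listrec_zero listrec_Suc)

lemma recin_const: "recursive_in x (\<lambda>_. c)"
  by (rule recin_if_listrec[where F = "\<lambda>_. enc c"]) (auto intro: listrec_const)

lemma recin_query: "recursive_in x x"
  unfolding recursive_in_def enc_nat_def enc_bool_def by (intro exI allI) (rule run.Query)

lemma recin_if_listrec2:
  assumes "list_recursive_in x 2 (\<lambda>ns. F (ns ! 0) (ns ! 1))" "\<And>a b. F (enc a) (enc b) = enc (f a b)"
    "recursive_in x g" "recursive_in x h"
  shows "recursive_in x (\<lambda>e. f (g e) (h e))"
proof -
  obtain p q r where p: "\<And>ns. length ns = 2 \<Longrightarrow> run x p ns (F (ns ! 0) (ns ! 1))"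
    and q: "\<And>e. run x q [enc e] (enc (g e))" and r: "\<And>e. run x r [enc e] (enc (h e))"
    using assms unfolding list_recursive_in_def recursive_in_def by metis
  have "run x (Comp p [q, r]) [enc e] (enc (f (g e) (h e)))" for e
    using run_comp2[OF q r p[of "[enc (g e), enc (h e)]", simplified]] by (simp add: assms(2))
  then show ?thesis unfolding recursive_in_def by blast
qed

lemma recin_Pair: "recursive_in x f \<Longrightarrow> recursive_in x g \<Longrightarrow> recursive_in x (\<lambda>e. (f e, g e))"
  by (rule recin_if_listrec2[where f = Pair, OF listrec_prod_encode]) auto

lemma recin_fst: "recursive_in x f \<Longrightarrow> recursive_in x (\<lambda>e. fst (f e))"
  by (rule recin_comp[of x fst], rule recin_if_listrec[OF listrec_fst]) auto

lemma recin_snd: "recursive_in x f \<Longrightarrow> recursive_in x (\<lambda>e. snd (f e))"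
  by (rule recin_comp[of x snd], rule recin_if_listrec[OF listrec_snd]) auto

text \<open>Only codes matter, so a function may be replaced by one into another type whose values
  have the same codes: a Boolean by \<open>0\<close> or \<open>1\<close>, a pair by the number
  encoding it.\<close>

lemma recin_recode: "recursive_in x f \<Longrightarrow> (\<And>a. enc (g a) = enc (f a)) \<Longrightarrow> recursive_in x g"
  unfolding recursive_in_def by simp

lemma recin_prod_encode: "recursive_in x f \<Longrightarrow> recursive_in x g \<Longrightarrow> recursive_in x (\<lambda>e. prod_encode (f e, g e))"
  by (drule (1) recin_Pair, erule recin_recode) auto

lemma recin_prod_decode: "recursive_in x f \<Longrightarrow> recursive_in x (\<lambda>e. prod_decode (f e))"
  by (erule recin_recode) auto

lemma recin_Suc: "recursive_in x f \<Longrightarrow> recursive_in x (\<lambda>e. Suc (f e))"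
  by (rule recin_comp[of x Suc], rule recin_if_listrec[where F = Suc]) (auto intro: listrec_Suc listrec_nth)

lemma recin_add: "recursive_in x f \<Longrightarrow> recursive_in x g \<Longrightarrow> recursive_in x (\<lambda>e. (f e :: nat) + g e)"
  by (rule recin_if_listrec2[where f = "(+)", OF listrec_add]) auto

lemma recin_diff: "recursive_in x f \<Longrightarrow> recursive_in x g \<Longrightarrow> recursive_in x (\<lambda>e. (f e :: nat) - g e)"
  by (rule recin_if_listrec2[where f = "(-)", OF listrec_diff]) auto

lemma recin_rec:
  fixes h :: "'a::enc \<Rightarrow> nat \<Rightarrow> 'b::enc \<Rightarrow> 'b"
  assumes "recursive_in x a" "recursive_in x (\<lambda>e. h (fst (fst e)) (snd (fst e)) (snd e))" "recursive_in x n"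
  shows "recursive_in x (\<lambda>e. rec_nat (a e) (h e) (n e))"
proof -
  obtain p q s where p: "\<And>e. run x p [enc e] (enc (a e))"
    and q: "\<And>e. run x q [enc e] (enc (h (fst (fst e)) (snd (fst e)) (snd e)))"
    and s: "\<And>e. run x s [enc e] (enc (n e))"
    using assms unfolding recursive_in_def by metis
  obtain u where u: "\<And>ns. length ns = 2 \<Longrightarrow> run x u ns (prod_encode (ns ! 0, ns ! 1))"
    using listrec_prod_encode unfolding list_recursive_in_def by metis
  \<comment> \<open>The recursion scheme supplies the arguments \<open>i\<close>,
    \<open>enc r\<close>, \<open>enc e\<close>; they are repacked as the code of
    \<open>((e, i), r)\<close>, which \<open>q\<close> expects.\<close>
  let ?q = "Comp q [Comp u [Comp u [Proj 2, Proj 0], Proj 1]]"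
  have *: "run x ?q (i # enc r # [enc e]) (enc (h e i r))" for e i r
  proof -
    have 1: "run x (Comp u [Proj 2, Proj 0]) [i, enc r, enc e] (prod_encode (enc e, i))"
      using run_comp2[OF run.Proj[of 2 "[i, enc r, enc e]" x] run.Proj[of 0 "[i, enc r, enc e]" x],
        of u "prod_encode (enc e, i)"]
        u[of "[enc e, i]"] by simp
    have "run x (Comp u [Comp u [Proj 2, Proj 0], Proj 1]) [i, enc r, enc e]
        (enc ((e, i), r))"
      using run_comp2[OF 1 run.Proj[of 1 "[i, enc r, enc e]" x],
        of u "prod_encode (prod_encode (enc e, i), enc r)"]
        u[of "[prod_encode (enc e, i), enc r]"] by simp
    from run_comp1[OF this q] show ?thesis by simp
  qed
  have "run x (PrimRec p ?q) [k, enc e] (enc (rec_nat (a e) (h e) k))" for k e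
  proof (induction k)
    case 0
    show ?case using p[of e] by (auto intro: run.PrimRec_0)
  next
    case (Suc k)
    show ?case using run.PrimRec_Suc[OF Suc *] by simp
  qed
  then have "run x (Comp (PrimRec p ?q) [s, Proj 0]) [enc e] (enc (rec_nat (a e) (h e) (n e)))" for e
    using run_comp2[OF s[of e] run.Proj[of 0 "[enc e]"]] by simp
  then show ?thesis unfolding recursive_in_def by blast
qed

section \<open>Closure properties of recursive functions\<close>

named_theorems recin_intros

lemmas [recin_intros] = recin_id recin_const recin_Pair recin_fst recin_snd recin_prod_encode recin_prod_decode recin_Suc
  recin_add recin_diff

text \<open>A conditional is a recursion of length \<open>1\<close> or \<open>0\<close>, according
  to the truth value, that starts at \<open>g e\<close> and steps to \<open>f e\<close>.\<close>

lemma recin_if [recin_intros]: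
  assumes "recursive_in x b" "recursive_in x f" "recursive_in x g"
  shows "recursive_in x (\<lambda>e. if b e then f e else g e)"
proof -
  have *: "recursive_in x (\<lambda>e. rec_nat (g e) (\<lambda>_ _. f e) (of_bool (b e) :: nat))"
    by (intro recin_rec recin_intros assms recin_comp[OF assms(2)] recin_recode[OF assms(1)]) auto
  show ?thesis by (rule recin_recode[OF *]) auto
qed

lemma recin_of_bool [recin_intros]: "recursive_in x b \<Longrightarrow> recursive_in x (\<lambda>e. of_bool (b e) :: nat)"
  by (erule recin_recode) auto

lemma recin_not [recin_intros]: "recursive_in x b \<Longrightarrow> recursive_in x (\<lambda>e. \<not> b e)"
  by (drule recin_if[where f = "\<lambda>_. False" and g = "\<lambda>_. True"], (rule recin_const)+, erule recin_recode) auto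

lemma recin_conj [recin_intros]: "recursive_in x b \<Longrightarrow> recursive_in x c \<Longrightarrow> recursive_in x (\<lambda>e. b e \<and> c e)"
  by (drule (1) recin_if[where g = "\<lambda>_. False"], rule recin_const, erule recin_recode) auto

lemma recin_disj [recin_intros]: "recursive_in x b \<Longrightarrow> recursive_in x c \<Longrightarrow> recursive_in x (\<lambda>e. b e \<or> c e)"
  by (drule recin_if[where f = "\<lambda>_. True" and g = c], (rule recin_const)+, assumption, erule recin_recode) auto

lemma recin_eq_0: "recursive_in x f \<Longrightarrow> recursive_in x (\<lambda>e. f e = (0::nat))"
  by (drule recin_diff[OF recin_const[of x "1::nat"]], erule recin_recode) auto

lemma recin_le [recin_intros]: "recursive_in x f \<Longrightarrow> recursive_in x g \<Longrightarrow> recursive_in x (\<lambda>e. (f e :: nat) \<le> g e)"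
  by (drule (1) recin_diff, drule recin_eq_0, erule recin_recode) auto

lemma recin_less [recin_intros]: "recursive_in x f \<Longrightarrow> recursive_in x g \<Longrightarrow> recursive_in x (\<lambda>e. (f e :: nat) < g e)"
  using recin_le[of x "\<lambda>e. Suc (f e)" g] by (simp add: recin_Suc Suc_le_eq)

lemma recin_eq [recin_intros]: "recursive_in x f \<Longrightarrow> recursive_in x g \<Longrightarrow> recursive_in x (\<lambda>e. (f e :: nat) = g e)"
  by (rule recin_recode[OF recin_conj[OF recin_le[of x f g] recin_le[of x g f]]]) auto

lemma recin_iff [recin_intros]: "recursive_in x f \<Longrightarrow> recursive_in x g \<Longrightarrow> recursive_in x (\<lambda>e. (f e :: bool) = g e)"
  by (rule recin_recode[OF recin_eq[OF recin_of_bool recin_of_bool, of x f g]]) auto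

lemma recin_mult [recin_intros]:
  assumes "recursive_in x f" "recursive_in x g"
  shows "recursive_in x (\<lambda>e. (f e :: nat) * g e)"
proof -
  have "recursive_in x (\<lambda>e. rec_nat 0 (\<lambda>_ r. r + g e) (f e))"
    by (intro recin_rec recin_intros assms recin_comp[OF assms(2)])
  moreover have "rec_nat 0 (\<lambda>_ r. r + b) n = n * b" for n b :: nat
    by (induction n) auto
  ultimately show ?thesis by simp
qed

lemma recin_power [recin_intros]:
  assumes "recursive_in x f" "recursive_in x g"
  shows "recursive_in x (\<lambda>e. (f e :: nat) ^ g e)"
proof -
  have "recursive_in x (\<lambda>e. rec_nat 1 (\<lambda>_ r. f e * r) (g e))"
    by (intro recin_rec recin_intros assms recin_comp[OF assms(1)])
  moreover have "rec_nat 1 (\<lambda>_ r. b * r) n = b ^ n" for n b :: nat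
    by (induction n) auto
  ultimately show ?thesis by simp
qed

lemma recin_sum [recin_intros]:
  fixes n :: "'a::enc \<Rightarrow> nat"
  assumes "recursive_in x (\<lambda>p. f (fst p) (snd p))" "recursive_in x n"
  shows "recursive_in x (\<lambda>e. \<Sum>i<n e. (f e i :: nat))"
proof -
  have "recursive_in x (\<lambda>e. rec_nat 0 (\<lambda>i r. r + f e i) (n e))"
    by (intro recin_rec recin_intros assms recin_comp[OF assms(1), of "\<lambda>e. fst e", simplified])
  moreover have "rec_nat 0 (\<lambda>i r. r + g i) n = (\<Sum>i<n. g i)" for n and g :: "nat \<Rightarrow> nat"
    by (induction n) auto
  ultimately show ?thesis by simp
qed

lemma recin_ex [recin_intros]:
  fixes n :: "'a::enc \<Rightarrow> nat"
  assumes "recursive_in x (\<lambda>p. f (fst p) (snd p))" "recursive_in x n"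
  shows "recursive_in x (\<lambda>e. \<exists>i<n e. f e i)"
proof -
  have "recursive_in x (\<lambda>e. 0 < (\<Sum>i<n e. of_bool (f e i) :: nat))"
    by (intro recin_intros assms)
  moreover have "0 < (\<Sum>i<n. of_bool (g i) :: nat) \<longleftrightarrow> (\<exists>i<n. g i)" for n :: nat and g
    by (induction n) (auto simp: less_Suc_eq)
  ultimately show ?thesis by simp
qed

lemma recin_all [recin_intros]:
  fixes n :: "'a::enc \<Rightarrow> nat"
  assumes "recursive_in x (\<lambda>p. f (fst p) (snd p))" "recursive_in x n"
  shows "recursive_in x (\<lambda>e. \<forall>i<n e. f e i)"
  using recin_not[OF recin_ex[OF recin_not[OF assms(1)] assms(2)]] by simp

lemma recin_ex_le [recin_intros]:
  fixes n :: "'a::enc \<Rightarrow> nat"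
  assumes "recursive_in x (\<lambda>p. f (fst p) (snd p))" "recursive_in x n"
  shows "recursive_in x (\<lambda>e. \<exists>i\<le>n e. f e i)"
  using recin_ex[OF assms(1) recin_Suc[OF assms(2)]] by (simp add: less_Suc_eq_le)

lemma recin_all_le [recin_intros]:
  fixes n :: "'a::enc \<Rightarrow> nat"
  assumes "recursive_in x (\<lambda>p. f (fst p) (snd p))" "recursive_in x n"
  shows "recursive_in x (\<lambda>e. \<forall>i\<le>n e. f e i)"
  using recin_all[OF assms(1) recin_Suc[OF assms(2)]] by (simp add: less_Suc_eq_le)

text \<open>A quotient counts the positive multiples of the divisor up to the dividend; divisor
  \<open>0\<close> follows the convention \<open>a div 0 = 0\<close>.\<close>

lemma recin_div [recin_intros]:
  assumes "recursive_in x f" "recursive_in x g"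
  shows "recursive_in x (\<lambda>e. (f e :: nat) div g e)"
proof -
  have *: "recursive_in x (\<lambda>e. if g e = 0 then 0 else \<Sum>i<f e. of_bool (Suc i * g e \<le> f e) :: nat)"
    by (intro recin_intros recin_comp[OF assms(1)] recin_comp[OF assms(2)] assms)
  have "a div b = (\<Sum>i<a. of_bool (Suc i * b \<le> a))" if "b > 0" for a b :: nat
  proof -
    have "(\<Sum>i<a. of_bool (Suc i * b \<le> a) :: nat) = (\<Sum>i<a. if i \<in> {..<a div b} then 1 else 0)"
      using that less_eq_div_iff_mult_less_eq[of b "Suc i" a for i]
      by (intro sum.cong) (simp_all add: Suc_le_eq del: mult_Suc)
    also have "\<dots> = card ({..<a} \<inter> {..<a div b})"
      by (subst sum.inter_restrict[symmetric]) simp_all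
    also have "{..<a} \<inter> {..<a div b} = {..<a div b}"
      using div_le_dividend[of a b] by (auto intro: less_le_trans)
    finally show ?thesis by simp
  qed
  then show ?thesis by (intro recin_recode[OF *]) auto
qed

lemma recin_mod [recin_intros]: "recursive_in x f \<Longrightarrow> recursive_in x g \<Longrightarrow> recursive_in x (\<lambda>e. (f e :: nat) mod g e)"
  unfolding modulo_nat_def by (intro recin_intros)

lemma recin_even [recin_intros]: "recursive_in x f \<Longrightarrow> recursive_in x (\<lambda>e. even (f e :: nat))"
  unfolding even_iff_mod_2_eq_zero by (intro recin_intros)

lemma recin_bit [recin_intros]: "recursive_in x f \<Longrightarrow> recursive_in x g \<Longrightarrow> recursive_in x (\<lambda>e. bit (f e :: nat) (g e))"
  unfolding bit_iff_odd by (intro recin_intros)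

lemma recin_take_bit [recin_intros]: "recursive_in x f \<Longrightarrow> recursive_in x g \<Longrightarrow> recursive_in x (\<lambda>e. take_bit (f e) (g e :: nat))"
  unfolding take_bit_eq_mod by (intro recin_intros)

lemma recin_set_decode [recin_intros]: "recursive_in x f \<Longrightarrow> recursive_in x g \<Longrightarrow> recursive_in x (\<lambda>e. f e \<in> set_decode (g e))"
  unfolding set_decode_def mem_Collect_eq by (intro recin_intros)

lemma recin_enc: "recursive_in x f \<Longrightarrow> recursive_in x (\<lambda>e. enc (f e))"
  by (erule recin_recode) simp

lemma recin_Cons [recin_intros]: "recursive_in x f \<Longrightarrow> recursive_in x l \<Longrightarrow> recursive_in x (\<lambda>e. f e # l e)"
  by (rule recin_recode[OF recin_Suc[OF recin_prod_encode[of x "\<lambda>e. enc (f e)" "\<lambda>e. enc (l e)"]]])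
    (use recin_enc[of x f] recin_enc[of x l] in simp_all)

lemma recin_list_encode [recin_intros]: "recursive_in x l \<Longrightarrow> recursive_in x (\<lambda>e. list_encode (l e))"
  by (erule recin_recode) (auto simp: map_idI)

text \<open>The list is built from its last entry backwards, each step of the recursion prepending
  one entry.\<close>

lemma recin_map_upt [recin_intros]:
  fixes f :: "'a::enc \<Rightarrow> nat \<Rightarrow> 'b::enc"
  assumes "recursive_in x (\<lambda>p. f (fst p) (snd p))" "recursive_in x n" "recursive_in x m"
  shows "recursive_in x (\<lambda>e. map (f e) [m e..<n e])"
proof -
  have f: "recursive_in x (\<lambda>e. f (g e) (h e))" if "recursive_in x g" "recursive_in x h" for g h
    using recin_comp[OF assms(1) recin_Pair[OF that]] by simp
  have "recursive_in x (\<lambda>e. rec_nat [] (\<lambda>i r. f e (n e - Suc i) # r) (n e - m e))"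
    by (intro recin_rec recin_intros f recin_comp[OF assms(2)] assms)
  moreover have "rec_nat [] (\<lambda>i r. g (n - Suc i) # r) k = map g [n - k..<n]" if "k \<le> n" for n k and g :: "nat \<Rightarrow> 'b"
    using that
  proof (induction k)
    case (Suc k)
    then have "[n - Suc k..<n] = (n - Suc k) # [n - k..<n]"
      by (subst upt_rec) (auto simp: Suc_diff_Suc)
    then show ?case using Suc by simp
  qed simp
  ultimately have *: "recursive_in x (\<lambda>e. map (f e) [n e - (n e - m e)..<n e])" by simp
  have "map g [n - (n - m)..<n] = map g [m..<n]" for m n and g :: "nat \<Rightarrow> 'b"
    by (cases "m \<le> n") auto
  with * show ?thesis by simp
qed

lemma recin_null [recin_intros]:
  assumes "recursive_in x l" shows "recursive_in x (\<lambda>e. l e = [])"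
proof -
  have *: "recursive_in x (\<lambda>e. enc (l e) = 0)"
    by (intro recin_intros recin_recode[OF assms]) auto
  show ?thesis by (rule recin_recode[OF *]) (case_tac "l a", auto)
qed

lemma recin_tl [recin_intros]:
  assumes "recursive_in x l" shows "recursive_in x (\<lambda>e. tl (l e))"
proof -
  have *: "recursive_in x (\<lambda>e. snd (prod_decode (enc (l e) - 1)))"
    by (intro recin_intros recin_recode[OF assms]) auto
  have "prod_decode 0 = (0, 0)" by (simp add: prod_decode_def prod_decode_aux.simps)
  then have "enc (tl l) = snd (prod_decode (enc l - 1))" for l :: "'b list"
    by (cases l) auto
  then show ?thesis by (intro recin_recode[OF *]) simp
qed

text \<open>A total variant of \<open>hd\<close>: the value on the empty list is what decoding the
  code \<open>0\<close> yields.\<close>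

definition head :: "nat list \<Rightarrow> nat" where
  "head l = (case l of [] \<Rightarrow> 0 | a # _ \<Rightarrow> a)"

lemma head_simps [simp]: "head [] = 0" "head (a # l) = a"
  by (simp_all add: head_def)

lemma recin_head [recin_intros]:
  assumes "recursive_in x l" shows "recursive_in x (\<lambda>e. head (l e))"
proof -
  have *: "recursive_in x (\<lambda>e. fst (prod_decode (enc (l e) - 1)))"
    by (intro recin_intros recin_recode[OF assms]) auto
  have "prod_decode 0 = (0, 0)" by (simp add: prod_decode_def prod_decode_aux.simps)
  then have "head l = fst (prod_decode (enc l - 1))" for l
    by (cases l) auto
  then show ?thesis by (intro recin_recode[OF *]) simp
qed

section \<open>Computably enumerable sets as unions of computable stages\<close>

text \<open>The value \<open>0\<close> stands for no result within the bound \<open>s\<close> on unbounded searches, the value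
  \<open>Suc r\<close> for the result \<open>r\<close>; queries are answered negatively.\<close>

fun eval_fuel :: "prog \<Rightarrow> nat \<Rightarrow> nat list \<Rightarrow> nat" where
  "eval_fuel Zero s ns = 1"
| "eval_fuel Succ s ns = (if ns \<noteq> [] \<and> tl ns = [] then Suc (Suc (head ns)) else 0)"
| "eval_fuel (Proj i) s ns = (if drop i ns = [] then 0 else Suc (head (drop i ns)))"
| "eval_fuel Query s ns = (if ns \<noteq> [] \<and> tl ns = [] then 1 else 0)"
| "eval_fuel (Comp f gs) s ns =
    (if \<exists>g\<in>set gs. eval_fuel g s ns = 0 then 0 else eval_fuel f s (map (\<lambda>g. eval_fuel g s ns - 1) gs))"
| "eval_fuel (PrimRec f g) s ns =
    (if ns = [] then 0 else
     rec_nat (eval_fuel f s (tl ns)) (\<lambda>k r. if r = 0 then 0 else eval_fuel g s (k # (r - 1) # tl ns)) (head ns))"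
| "eval_fuel (Mu f) s ns =
    (\<Sum>k<s. if eval_fuel f s (k # ns) = 1 \<and> (\<forall>i<k. 1 < eval_fuel f s (i # ns)) then Suc k else 0)"

declare eval_fuel.simps(6) [simp del]

lemma eval_fuel_PrimRec_Cons [simp]:
  "eval_fuel (PrimRec f g) s (k # ns) =
    rec_nat (eval_fuel f s ns) (\<lambda>k r. if r = 0 then 0 else eval_fuel g s (k # (r - 1) # ns)) k"
  by (simp only: eval_fuel.simps list.sel head_simps list.distinct if_False)

lemma recin_drop: "recursive_in x l \<Longrightarrow> recursive_in x (\<lambda>e. drop i (l e))"
  by (induction i arbitrary: l) (auto simp: drop_Suc intro!: recin_tl)

text \<open>By induction on \<open>p\<close>: the program is fixed and only fuel and arguments vary,
  so the closure properties suffice and no universal program is built.\<close>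

lemma recin_eval_fuel: "recursive_in x a \<Longrightarrow> recursive_in x b \<Longrightarrow> recursive_in x (\<lambda>e. eval_fuel p (a e) (b e))"
proof -
  have "recursive_in x (\<lambda>e. eval_fuel p (fst e) (snd e))"
  proof (induction p)
    case (Comp f gs)
    have "recursive_in x (\<lambda>e. \<exists>g\<in>set gs. eval_fuel g (fst e) (snd e) = 0)" using Comp.IH(2)
      by (induction gs) (auto intro!: recin_intros)
    moreover have "recursive_in x (\<lambda>e. map (\<lambda>g. eval_fuel g (fst e) (snd e) - 1) gs)" using Comp.IH(2)
      by (induction gs) (auto intro!: recin_intros simp del: One_nat_def)
    ultimately show ?case unfolding eval_fuel.simps
      by (intro recin_intros recin_comp[OF Comp.IH(1), OF recin_Pair, unfolded fst_conv snd_conv])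
  next
    case (PrimRec f g)
    show ?case unfolding eval_fuel.simps
      by (intro recin_rec recin_intros recin_comp[OF PrimRec.IH(1), OF recin_Pair, unfolded fst_conv snd_conv]
        recin_comp[OF PrimRec.IH(2), OF recin_Pair, unfolded fst_conv snd_conv])
  next
    case (Mu f)
    show ?case unfolding eval_fuel.simps
      by (intro recin_intros recin_comp[OF Mu.IH, OF recin_Pair, unfolded fst_conv snd_conv])
  qed (unfold eval_fuel.simps, (intro recin_intros recin_drop)+)
  then show "recursive_in x a \<Longrightarrow> recursive_in x b \<Longrightarrow> recursive_in x (\<lambda>e. eval_fuel p (a e) (b e))"
    using recin_comp[of x "\<lambda>e. eval_fuel p (fst e) (snd e)", OF _ recin_Pair] by simp
qed

text \<open>At most one \<open>k\<close> ends the search, since it has to give \<open>0\<close>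
  itself while everything below it gives a successor. Hence the sum in \<open>eval_fuel\<close> has
  at most one nonzero term.\<close>

lemma eval_fuel_Mu_iff:
  "eval_fuel (Mu f) s ns = Suc r \<longleftrightarrow>
    r < s \<and> eval_fuel f s (r # ns) = 1 \<and> (\<forall>i<r. 1 < eval_fuel f s (i # ns))"
proof -
  define Q where "Q k \<longleftrightarrow> eval_fuel f s (k # ns) = 1 \<and> (\<forall>i<k. 1 < eval_fuel f s (i # ns))" for k
  have "\<not> k < l" if "Q k" "Q l" for k l
  proof
    assume "k < l"
    then have "1 < eval_fuel f s (k # ns)" using \<open>Q l\<close> unfolding Q_def by blast
    then show False using \<open>Q k\<close> unfolding Q_def by simp
  qed
  then have uniq: "Q k \<longleftrightarrow> k = r" if "Q r" for k r
    using that by (metis linorder_neq_iff)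
  have *: "(\<Sum>k<s. if Q k then Suc k else 0) = Suc r" if "r < s" "Q r" for r
    unfolding uniq[OF that(2)] using that(1) by simp
  have sum_form: "eval_fuel (Mu f) s ns = (\<Sum>k<s. if Q k then Suc k else 0)"
    by (simp add: Q_def)
  show ?thesis
  proof
    assume r: "eval_fuel (Mu f) s ns = Suc r"
    have "\<exists>k<s. Q k"
    proof (rule ccontr)
      assume "\<not> (\<exists>k<s. Q k)"
      then have "eval_fuel (Mu f) s ns = 0" unfolding sum_form by (intro sum.neutral) auto
      with r show False by simp
    qed
    then obtain k where "k < s" "Q k" by blast
    with *[of k] r show "r < s \<and> eval_fuel f s (r # ns) = 1 \<and> (\<forall>i<r. 1 < eval_fuel f s (i # ns))"
      unfolding sum_form Q_def by simp
  next
    assume "r < s \<and> eval_fuel f s (r # ns) = 1 \<and> (\<forall>i<r. 1 < eval_fuel f s (i # ns))"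
    then show "eval_fuel (Mu f) s ns = Suc r" using *[of r] unfolding sum_form Q_def by blast
  qed
qed

text \<open>Lets the fuels of several subcomputations be raised to a common bound, and makes the
  stages of an enumeration increase.\<close>

lemma eval_fuel_mono:
  assumes "s \<le> t"
  shows "eval_fuel p s ns = Suc r \<Longrightarrow> eval_fuel p t ns = Suc r"
proof (induction p arbitrary: ns r)
  case (Comp f gs)
  have nz: "eval_fuel g s ns \<noteq> 0" if "g \<in> set gs" for g
    using Comp.prems that by (auto split: if_splits)
  have eq: "eval_fuel g t ns = eval_fuel g s ns" if "g \<in> set gs" for g
    using Comp.IH(2)[OF that, of ns "eval_fuel g s ns - 1"] nz[OF that] by simp
  have "eval_fuel f s (map (\<lambda>g. eval_fuel g s ns - 1) gs) = Suc r"
    using Comp.prems by (auto split: if_splits)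
  from Comp.IH(1)[OF this] show ?case
    using nz eq by (auto cong: map_cong)
next
  case (PrimRec f g)
  then obtain k ms where ns: "ns = k # ms" by (cases ns) (auto simp: eval_fuel.simps(6))
  let ?F = "\<lambda>s k. rec_nat (eval_fuel f s ms) (\<lambda>k r. if r = 0 then 0 else eval_fuel g s (k # (r - 1) # ms)) k"
  have "?F s k = Suc r \<Longrightarrow> ?F t k = Suc r" for r
  proof (induction k arbitrary: r)
    case 0
    then show ?case using PrimRec.IH(1) by simp
  next
    case (Suc k)
    then obtain q where q: "?F s k = Suc q" by (cases "?F s k") auto
    with Suc.prems have "eval_fuel g s (k # q # ms) = Suc r" by simp
    with Suc.IH[OF q] show ?case using PrimRec.IH(2) by simp
  qed
  with PrimRec.prems show ?case by (simp add: ns)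
next
  case (Mu f)
  then have r: "r < s" "eval_fuel f s (r # ns) = Suc 0" "\<And>i. i < r \<Longrightarrow> 1 < eval_fuel f s (i # ns)"
    unfolding eval_fuel_Mu_iff by auto
  have "1 < eval_fuel f t (i # ns)" if "i < r" for i
    using Mu.IH[of "i # ns" "eval_fuel f s (i # ns) - 1"] r(3)[OF that] by simp
  with r Mu.IH[OF r(2)] assms show ?case unfolding eval_fuel_Mu_iff by simp
qed simp_all

lemma run_if_eval_fuel: "eval_fuel p s ns = Suc r \<Longrightarrow> run (\<lambda>_. False) p ns r"
proof (induction p arbitrary: ns r)
  case Zero
  then show ?case by (auto intro: run.Zero)
next
  case Succ
  then show ?case by (cases ns) (auto split: if_splits intro: run.Succ)
next
  case (Proj i)
  then have "i < length ns" "r = ns ! i"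
    by (auto split: if_splits simp: Cons_nth_drop_Suc[symmetric])
  then show ?case by (auto intro: run.Proj)
next
  case Query
  then show ?case using run.Query[of "\<lambda>_. False" "hd ns"] by (cases ns) (auto split: if_splits)
next
  case (Comp f gs)
  have nz: "eval_fuel g s ns \<noteq> 0" if "g \<in> set gs" for g
    using Comp.prems that by (auto split: if_splits)
  show ?case
  proof (rule run.Comp[where ms = "map (\<lambda>g. eval_fuel g s ns - 1) gs"])
    show "run (\<lambda>_. False) (gs ! i) ns (map (\<lambda>g. eval_fuel g s ns - 1) gs ! i)" if "i < length gs" for i
      using that nz[of "gs ! i"] Comp.IH(2)[of "gs ! i" ns] by simp
    show "run (\<lambda>_. False) f (map (\<lambda>g. eval_fuel g s ns - 1) gs) r"
      using Comp.prems by (intro Comp.IH(1)) (auto split: if_splits)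
  qed simp
next
  case (PrimRec f g)
  then obtain k ms where ns: "ns = k # ms" by (cases ns) (auto simp: eval_fuel.simps(6))
  let ?F = "\<lambda>k. rec_nat (eval_fuel f s ms) (\<lambda>k r. if r = 0 then 0 else eval_fuel g s (k # (r - 1) # ms)) k"
  have "?F k = Suc r \<Longrightarrow> run (\<lambda>_. False) (PrimRec f g) (k # ms) r" for r
  proof (induction k arbitrary: r)
    case 0
    then show ?case using PrimRec.IH(1) by (auto intro: run.PrimRec_0)
  next
    case (Suc k)
    then obtain q where q: "?F k = Suc q" by (cases "?F k") auto
    with Suc.prems have "eval_fuel g s (k # q # ms) = Suc r" by simp
    with Suc.IH[OF q] show ?case using PrimRec.IH(2) by (auto intro: run.PrimRec_Suc)
  qed
  with PrimRec.prems show ?case by (simp add: ns)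
next
  case (Mu f)
  then have r: "eval_fuel f s (r # ns) = Suc 0" "\<And>i. i < r \<Longrightarrow> 1 < eval_fuel f s (i # ns)"
    unfolding eval_fuel_Mu_iff by auto
  show ?case
  proof (rule run.Mu[where h = "\<lambda>i. eval_fuel f s (i # ns) - 2"])
    show "run (\<lambda>_. False) f (i # ns) (Suc (eval_fuel f s (i # ns) - 2))" if "i < r" for i
      using r(2)[OF that] by (intro Mu.IH) simp
  qed (use r Mu.IH in auto)
qed

lemma eval_fuel_if_run: "run (\<lambda>_. False) p ns r \<Longrightarrow> \<exists>s. eval_fuel p s ns = Suc r"
proof (induction p ns r rule: run.induct)
  case (Proj i ns)
  then have "eval_fuel (Proj i) s ns = Suc (ns ! i)" for s
    using Cons_nth_drop_Suc[OF Proj] by (metis eval_fuel.simps(3) head_simps(2) list.distinct(1))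
  then show ?case ..
next
  case (Comp ms gs ns f r)
  then obtain t where t: "\<And>i. i < length gs \<Longrightarrow> eval_fuel (gs ! i) (t i) ns = Suc (ms ! i)" by metis
  obtain u where u: "eval_fuel f u ms = Suc r" using Comp by blast
  \<comment> \<open>Fuel for all subcomputations at once: the sum bounds each of its terms.\<close>
  define s where "s = u + (\<Sum>i<length gs. t i)"
  have "eval_fuel (gs ! i) s ns = Suc (ms ! i)" if "i < length gs" for i
    using that member_le_sum[of i "{..<length gs}" t] unfolding s_def
    by (intro eval_fuel_mono[OF _ t]) auto
  then have "\<And>g. g \<in> set gs \<Longrightarrow> eval_fuel g s ns \<noteq> 0" "map (\<lambda>g. eval_fuel g s ns - 1) gs = ms"
    using Comp(1) by (auto simp: in_set_conv_nth intro!: nth_equalityI)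
  moreover have "eval_fuel f s ms = Suc r" by (rule eval_fuel_mono[OF _ u]) (simp add: s_def)
  ultimately have "eval_fuel (Comp f gs) s ns = Suc r" by auto
  then show ?case ..
next
  case (PrimRec_0 f ns r g)
  then show ?case by auto
next
  case (PrimRec_Suc f g k ns r s)
  then obtain a b where a: "eval_fuel (PrimRec f g) a (k # ns) = Suc r" and b: "eval_fuel g b (k # r # ns) = Suc s"
    by blast
  have "eval_fuel (PrimRec f g) (max a b) (k # ns) = Suc r" "eval_fuel g (max a b) (k # r # ns) = Suc s"
    using eval_fuel_mono[OF _ a] eval_fuel_mono[OF _ b] by auto
  then have "eval_fuel (PrimRec f g) (max a b) (Suc k # ns) = Suc s" by simp
  then show ?case ..
next
  case (Mu f k ns h)
  then obtain t u where t: "\<And>i. i < k \<Longrightarrow> eval_fuel f (t i) (i # ns) = Suc (Suc (h i))"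
    and u: "eval_fuel f u (k # ns) = Suc 0" by metis
  \<comment> \<open>\<open>Suc k\<close> is added because a search with fuel \<open>s\<close> tries
    only candidates below \<open>s\<close>.\<close>
  define s where "s = Suc k + u + (\<Sum>i<k. t i)"
  have "eval_fuel f s (i # ns) = Suc (Suc (h i))" if "i < k" for i
    using that member_le_sum[of i "{..<k}" t] unfolding s_def by (intro eval_fuel_mono[OF _ t]) auto
  moreover have "eval_fuel f s (k # ns) = Suc 0" by (rule eval_fuel_mono[OF _ u]) (simp add: s_def)
  ultimately have "eval_fuel (Mu f) s ns = Suc k" unfolding eval_fuel_Mu_iff by (simp add: s_def)
  then show ?case ..
qed auto

text \<open>If a search had two different results, the smaller one would be evaluated both to
  \<open>0\<close> and to a successor; the other cases are structural.\<close>

lemma run_det: "run x p ns r \<Longrightarrow> run x p ns r' \<Longrightarrow> r' = r"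
proof (induction p ns r arbitrary: r' rule: run.induct)
  case (Comp ms gs ns f r)
  from Comp.prems show ?case
  proof cases
    case (Comp ms')
    then have "ms' = ms" using Comp.IH(1) \<open>length ms = length gs\<close> by (intro nth_equalityI) auto
    then show ?thesis using Comp Comp.IH(2) by simp
  qed
next
  case (PrimRec_0 f ns r g)
  from PrimRec_0.prems show ?case by cases (use PrimRec_0.IH in auto)
next
  case (PrimRec_Suc f g k ns r s)
  from PrimRec_Suc.prems show ?case by cases (use PrimRec_Suc.IH in blast)
next
  case (Mu f k ns h)
  note IH = Mu.IH
  from Mu.prems show ?case
  proof cases
    case (Mu h')
    show ?thesis
    proof (cases k r' rule: linorder_cases)
      case less
      then show ?thesis using IH(1)[OF Mu(2)] by simp
    next
      case greater
      then show ?thesis using IH(2)[OF greater Mu(1)] by simp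
    qed simp
  qed
qed (auto elim: run.cases)

text \<open>Stage \<open>s\<close> is evaluation with fuel \<open>s\<close>. It is recursive in
  every oracle, as \<open>eval_fuel\<close> answers queries without consulting one.\<close>

lemma uniformly_ce_stages:
  assumes "uniformly_ce U"
  shows "\<exists>D :: nat \<Rightarrow> nat \<Rightarrow> nat \<Rightarrow> bool.
    (\<forall>x. recursive_in x (\<lambda>e. D (fst (fst e)) (snd (fst e)) (snd e))) \<and>
    (\<forall>n c s t. D n c s \<longrightarrow> s \<le> t \<longrightarrow> D n c t) \<and>
    (\<forall>n w. w \<in> U n \<longleftrightarrow> (\<exists>s. D n (string_code w) s))"
proof -
  obtain p where p: "\<And>n w. w \<in> U n \<longleftrightarrow> (\<exists>r. run (\<lambda>_. False) p [n, string_code w] r)"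
    using assms unfolding uniformly_ce_def by blast
  show ?thesis
  proof (intro exI[of _ "\<lambda>n c s. 0 < eval_fuel p s [n, c]"] conjI allI impI)
    show "recursive_in x (\<lambda>e. 0 < eval_fuel p (snd e) [fst (fst e), snd (fst e)])" for x
      by (intro recin_intros recin_eval_fuel)
    show "0 < eval_fuel p t [n, c]" if "0 < eval_fuel p s [n, c]" "s \<le> t" for n c s t
      using that eval_fuel_mono[OF that(2), of p "[n, c]"] by (metis gr0_conv_Suc)
    show "w \<in> U n \<longleftrightarrow> (\<exists>s. 0 < eval_fuel p s [n, string_code w])" for n w
      unfolding p using eval_fuel_if_run run_if_eval_fuel by (metis gr0_conv_Suc)
  qed
qed

text \<open>Membership is semi-decided by searching for a stage; the predicate is negated because
  \<open>Mu\<close> stops at \<open>0\<close>.\<close>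

lemma uniformly_ce_if_recursive_in:
  fixes Q :: "nat \<Rightarrow> nat \<Rightarrow> nat \<Rightarrow> bool"
  assumes "recursive_in (\<lambda>_. False) (\<lambda>e. Q (fst (fst e)) (snd (fst e)) (snd e))"
  shows "uniformly_ce (\<lambda>n. {w. \<exists>s. Q n (string_code w) s})"
proof -
  let ?o = "\<lambda>_::nat. False"
  have "recursive_in ?o (\<lambda>e. \<not> Q (fst (fst e)) (snd (fst e)) (snd e))"
    by (rule recin_not[OF assms])
  then obtain p where "\<And>a. run ?o p [enc a] (enc (\<not> Q (fst (fst a)) (snd (fst a)) (snd a)))"
    unfolding recursive_in_def by blast
  from this[of "((n, c), s)" for n c s]
  have p: "run ?o p [prod_encode (prod_encode (n, c), s)] (of_bool (\<not> Q n c s))" for n c s by simp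
  obtain u where u: "\<And>ns. length ns = 2 \<Longrightarrow> run ?o u ns (prod_encode (ns ! 0, ns ! 1))"
    using listrec_prod_encode unfolding list_recursive_in_def by metis
  \<comment> \<open>\<open>Mu\<close> puts the search variable in front, so the arguments
    \<open>s\<close>, \<open>n\<close>, \<open>c\<close> are reordered into the code of
    \<open>((n, c), s)\<close>.\<close>
  let ?q = "Comp p [Comp u [Comp u [Proj 1, Proj 2], Proj 0]]"
  have q: "run ?o ?q [s, n, c] (of_bool (\<not> Q n c s))" for n c s
  proof -
    have 1: "run ?o (Comp u [Proj 1, Proj 2]) [s, n, c] (prod_encode (n, c))"
      using run_comp2[OF run.Proj[of 1 "[s, n, c]" ?o] run.Proj[of 2 "[s, n, c]" ?o],
        of u "prod_encode (n, c)"] u[of "[n, c]"] by simp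
    have "run ?o (Comp u [Comp u [Proj 1, Proj 2], Proj 0]) [s, n, c] (prod_encode (prod_encode (n, c), s))"
      using run_comp2[OF 1 run.Proj[of 0 "[s, n, c]" ?o],
        of u "prod_encode (prod_encode (n, c), s)"] u[of "[prod_encode (n, c), s]"] by simp
    from run_comp1[OF this p] show ?thesis .
  qed
  have "(\<exists>r. run ?o (Mu ?q) [n, c] r) \<longleftrightarrow> (\<exists>s. Q n c s)" for n c
  proof
    assume "\<exists>r. run ?o (Mu ?q) [n, c] r"
    then obtain r where "run ?o (Mu ?q) [n, c] r" ..
    then have "run ?o ?q [r, n, c] 0" by cases auto
    then have "of_bool (\<not> Q n c r) = (0::nat)" using run_det q by metis
    then show "\<exists>s. Q n c s" by auto
  next
    assume "\<exists>s. Q n c s"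
    define r where "r = (LEAST s. Q n c s)"
    have r: "Q n c r" "\<And>i. i < r \<Longrightarrow> \<not> Q n c i"
      using \<open>\<exists>s. Q n c s\<close> unfolding r_def by (auto intro: LeastI_ex dest: not_less_Least)
    have "run ?o (Mu ?q) [n, c] r"
    proof (rule run.Mu[where h = "\<lambda>_. 0"])
      show "run ?o ?q [r, n, c] 0" using q[of r n c] r(1) by simp
      show "run ?o ?q [i, n, c] (Suc 0)" if "i < r" for i using q[of i n c] r(2)[OF that] by simp
    qed
    then show "\<exists>r. run ?o (Mu ?q) [n, c] r" ..
  qed
  then show ?thesis unfolding uniformly_ce_def by (intro exI[of _ "Mu ?q"]) simp
qed

lemma computable_if_recursive_in: "recursive_in (\<lambda>_. False) f \<Longrightarrow> computable f"
  by (simp add: recursive_in_def computable_def)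

lemma turing_reducible_if_recursive_in: "recursive_in x y \<Longrightarrow> y \<le>\<^sub>T x"
  by (simp add: recursive_in_def turing_reducible_def)

section \<open>Coin tossing and the second moment method\<close>

definition coin :: "(nat \<Rightarrow> bool) measure" where
  "coin = PiM UNIV (\<lambda>_. measure_pmf (bernoulli_pmf (1/2)))"

definition forced :: "nat set \<Rightarrow> (nat \<Rightarrow> bool) \<Rightarrow> nat \<Rightarrow> bool" where
  "forced J b = (\<lambda>i. b i \<or> i \<in> J)"

lemma space_coin [simp]: "space coin = UNIV"
  by (simp add: coin_def space_PiM)

interpretation coin: product_prob_space "\<lambda>_::nat. measure_pmf (bernoulli_pmf (1/2))" UNIV
  rewrites "PiM UNIV (\<lambda>_. measure_pmf (bernoulli_pmf (1/2))) = coin"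
  by unfold_locales (simp_all add: coin_def)

lemma measurable_coin_component [measurable]: "(\<lambda>b. b i) \<in> measurable coin (count_space UNIV)"
proof -
  have "(\<lambda>b. b i) \<in> measurable coin (measure_pmf (bernoulli_pmf (1/2)))"
    unfolding coin_def by (rule measurable_component_singleton) simp
  moreover have "measurable coin (count_space UNIV) = measurable coin (measure_pmf (bernoulli_pmf (1/2)))"
    by (rule measurable_cong_sets) simp_all
  ultimately show ?thesis by (simp only:)
qed

lemma measurable_into_coin:
  assumes "\<And>i. Measurable.pred M (\<lambda>x. f x i)"
  shows "f \<in> measurable M coin"
  unfolding coin_def
  by (rule measurable_PiM_single') (use assms in \<open>auto cong: measurable_cong_sets\<close>)

lemma measurable_forced [measurable]: "forced J \<in> measurable coin coin"
  unfolding forced_def by (rule measurable_into_coin) measurable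

lemma measurable_fun_upd_coin [measurable]: "(\<lambda>b. b(a := v)) \<in> measurable coin coin"
  by (rule measurable_into_coin) (simp add: fun_upd_def)

lemma coin_prescribed:
  assumes "finite J"
  shows "measure coin {b. \<forall>i\<in>J. b i = w i} = (1/2) ^ card J"
proof -
  have "emeasure coin {b\<in>space coin. \<forall>i\<in>J. b i \<in> {w i}} =
      (\<Prod>i\<in>J. emeasure (measure_pmf (bernoulli_pmf (1/2))) {w i})"
    by (rule coin.emeasure_PiM_Collect) (use assms in auto)
  also have "\<dots> = (\<Prod>i\<in>J. ennreal (1/2))"
    by (intro prod.cong) (auto simp: emeasure_pmf_single)
  also have "\<dots> = ennreal ((1/2) ^ card J)"
    unfolding prod_constant by (rule ennreal_power) simp
  finally show ?thesis by (simp add: measure_def)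
qed

lemma sets_forced: "A \<in> sets coin \<Longrightarrow> {b. forced J b \<in> A} \<in> sets coin"
  using measurable_sets[OF measurable_forced, of A J] by (simp add: vimage_def)

lemma sets_component: "{b. b i} \<in> sets coin"
  using measurable_sets[OF measurable_coin_component, of "{True}" i] by (simp add: vimage_def)

lemma sets_prescribed: "finite J \<Longrightarrow> {b. \<forall>i\<in>J. b i = w i} \<in> sets coin"
proof -
  assume "finite J"
  have "{b \<in> space coin. \<forall>i\<in>J. b i = w i} \<in> sets coin"
    using \<open>finite J\<close> by measurable
  then show ?thesis by simp
qed

text \<open>Setting a coin to heads has the same effect as conditioning on heads, an event of
  probability one half that is independent of the other coins.\<close>

lemma coin_force_one:
  assumes "A \<in> sets coin"
  shows "measure coin {b. b(a := True) \<in> A} = 2 * measure coin {b \<in> A. b a}"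
proof -
  let ?B = "measure_pmf (bernoulli_pmf (1/2))"
  let ?C = "{b \<in> A. b a}"
  have C: "?C \<in> sets coin" using sets.Int[OF assms sets_component[of a]] by (simp add: Int_def)
  have upd: "(\<lambda>(v, b). b(a := v)) \<in> measurable (?B \<Otimes>\<^sub>M coin) coin"
    by (rule measurable_into_coin) (simp add: fun_upd_def split_beta, measurable)
  have vimage: "(\<lambda>(v, b). b(a := v)) -` ?C \<inter> space (?B \<Otimes>\<^sub>M coin) = {True} \<times> {b. b(a := True) \<in> A}"
    by (auto simp: space_pair_measure)
  have sets': "{b. b(a := True) \<in> A} \<in> sets coin"
    using measurable_sets[OF measurable_fun_upd_coin assms, of a True] by (simp add: vimage_def)
  \<comment> \<open>Tossing coin \<open>a\<close> afresh, independently of the rest, does not change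
    the distribution.\<close>
  have "coin = distr (?B \<Otimes>\<^sub>M coin) coin (\<lambda>(v, b). b(a := v))"
    using distr_pair_PiM_eq_PiM[of UNIV "\<lambda>_. ?B" a] by (simp add: coin_def prob_space_measure_pmf)
  then have "emeasure coin ?C = emeasure (distr (?B \<Otimes>\<^sub>M coin) coin (\<lambda>(v, b). b(a := v))) ?C"
    by simp
  also have "\<dots> = emeasure (?B \<Otimes>\<^sub>M coin) ({True} \<times> {b. b(a := True) \<in> A})"
    unfolding emeasure_distr[OF upd C] vimage ..
  also have "\<dots> = emeasure ?B {True} * emeasure coin {b. b(a := True) \<in> A}"
    using sets' by (intro coin.emeasure_pair_measure_Times) auto
  also have "emeasure ?B {True} = ennreal (1/2)" by (simp add: emeasure_pmf_single)
  finally have *: "emeasure coin ?C = ennreal (1/2) * emeasure coin {b. b(a := True) \<in> A}" .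
  have "measure coin ?C = 1/2 * measure coin {b. b(a := True) \<in> A}"
    unfolding measure_def * enn2real_mult by (subst enn2real_ennreal) simp_all
  then show ?thesis by simp
qed

text \<open>Adding \<open>J\<close> to a random set is conditioning on \<open>J\<close> being
  contained in it, an event of probability \<open>(1/2) ^ card J\<close>; one coin is forced at a
  time.\<close>

lemma coin_forced:
  assumes "finite J" "A \<in> sets coin"
  shows "measure coin {b. forced J b \<in> A} = 2 ^ card J * measure coin {b \<in> A. \<forall>i\<in>J. b i}"
  using assms
proof (induction J arbitrary: A)
  case empty
  then show ?case by (simp add: forced_def)
next
  case (insert a J)
  have *: "forced (insert a J) b = forced J (b(a := True))" for b
    using insert.hyps by (auto simp: forced_def)
  have "measure coin {b. forced (insert a J) b \<in> A} = measure coin {b. b(a := True) \<in> {b. forced J b \<in> A}}"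
    by (simp add: *)
  also have "\<dots> = 2 * measure coin {b. forced J b \<in> {b \<in> A. b a}}"
    using insert.hyps
    by (subst coin_force_one[OF sets_forced[OF insert.prems]]) (simp add: forced_def)
  also have "\<dots> = 2 * (2 ^ card J * measure coin {b \<in> {b \<in> A. b a}. \<forall>i\<in>J. b i})"
    using sets.Int[OF insert.prems sets_component[of a]]
    by (subst insert.IH) (simp_all add: Int_def)
  also have "{b \<in> {b \<in> A. b a}. \<forall>i\<in>J. b i} = {b \<in> A. \<forall>i\<in>insert a J. b i}"
    by auto
  finally show ?case using insert.hyps by simp
qed

text \<open>Weighting the indicator of \<open>A v \<subseteq> b\<close> by \<open>\<mu> v * 2 ^ card (A v)\<close> gives a random variable \<open>Z\<close> whose
  second moment is the left hand side of \<open>energy\<close> and whose mean on \<open>E\<close> is at least \<open>\<epsilon> * sum \<mu> V\<close>;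
  compare the two by the arithmetic-geometric mean inequality.\<close>

lemma second_moment:
  fixes \<mu> :: "'v \<Rightarrow> real" and A :: "'v \<Rightarrow> nat set"
  assumes fin: "finite V" "\<And>v. v \<in> V \<Longrightarrow> finite (A v)"
    and pos: "\<And>v. v \<in> V \<Longrightarrow> 0 \<le> \<mu> v" and E: "E \<in> sets coin" and "0 < \<epsilon>" "0 < C"
    and likely: "\<And>v. v \<in> V \<Longrightarrow> \<epsilon> \<le> measure coin {b. forced (A v) b \<in> E}"
    and energy: "(\<Sum>v\<in>V. \<Sum>w\<in>V. \<mu> v * \<mu> w * 2 ^ card (A v \<inter> A w)) \<le> C * sum \<mu> V"
  shows "\<epsilon>\<^sup>2 * sum \<mu> V \<le> C * measure coin E"
proof -
  define S where "S v = {b::nat \<Rightarrow> bool. \<forall>i\<in>A v. b i}" for v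
  have S: "S v \<in> sets coin" if "v \<in> V" for v
    using sets_prescribed[OF fin(2)[OF that], of "\<lambda>_. True"] by (simp add: S_def)
  have SS: "measure coin (S v \<inter> S w) = (1/2) ^ card (A v \<union> A w)" if "v \<in> V" "w \<in> V" for v w
  proof -
    have "S v \<inter> S w = {b. \<forall>i\<in>A v \<union> A w. b i = True}" by (auto simp: S_def)
    then show ?thesis using coin_prescribed[of "A v \<union> A w" "\<lambda>_. True"] fin that by simp
  qed
  define Z where "Z b = (\<Sum>v\<in>V. \<mu> v * 2 ^ card (A v) * indicator (S v) b)" for b
  have int_ind: "integrable coin (\<lambda>b. indicator X b :: real)" if "X \<in> sets coin" for X
    using that by (simp add: coin.P.emeasure_finite less_top[symmetric])
  define Q where "Q b = (\<Sum>v\<in>V. \<Sum>w\<in>V. \<mu> v * \<mu> w * 2 ^ (card (A v) + card (A w)) *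
      (indicator (S v \<inter> S w) b :: real))" for b
  define T where "T b = (\<Sum>v\<in>V. \<mu> v * 2 ^ card (A v) * (indicator (E \<inter> S v) b :: real))" for b
  have Z2: "(Z b)\<^sup>2 = Q b" for b
    unfolding Z_def Q_def power2_eq_square sum_product
    by (intro sum.cong refl) (simp add: indicator_inter_arith power_add mult_ac)
  have ZE: "Z b * indicator E b = T b" for b
    unfolding Z_def T_def sum_distrib_right
    by (intro sum.cong refl) (simp add: indicator_inter_arith mult_ac)
  have intQ: "integrable coin Q"
    unfolding Q_def by (intro Bochner_Integration.integrable_sum integrable_mult_right int_ind sets.Int S)
  have intT: "integrable coin T"
    unfolding T_def by (intro Bochner_Integration.integrable_sum integrable_mult_right int_ind sets.Int S E)
  have "integral\<^sup>L coin Q =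
      (\<Sum>v\<in>V. \<Sum>w\<in>V. \<mu> v * \<mu> w * 2 ^ (card (A v) + card (A w)) * measure coin (S v \<inter> S w))"
  proof -
    have int: "integrable coin (\<lambda>b. \<mu> v * \<mu> w * 2 ^ (card (A v) + card (A w)) *
        (indicator (S v \<inter> S w) b :: real))" if "v \<in> V" "w \<in> V" for v w
      by (intro integrable_mult_right int_ind sets.Int S that)
    show ?thesis unfolding Q_def
      by (subst Bochner_Integration.integral_sum, intro Bochner_Integration.integrable_sum int, assumption+)
        (intro sum.cong refl, subst Bochner_Integration.integral_sum, rule int, assumption+, simp)
  qed
  also have "\<dots> = (\<Sum>v\<in>V. \<Sum>w\<in>V. \<mu> v * \<mu> w * 2 ^ card (A v \<inter> A w))"
  proof (intro sum.cong refl)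
    fix v w assume vw: "v \<in> V" "w \<in> V"
    have "card (A v) + card (A w) = card (A v \<union> A w) + card (A v \<inter> A w)"
      using fin vw by (intro card_Un_Int) auto
    then show "\<mu> v * \<mu> w * 2 ^ (card (A v) + card (A w)) * measure coin (S v \<inter> S w) =
        \<mu> v * \<mu> w * 2 ^ card (A v \<inter> A w)"
      by (simp add: SS[OF vw] power_add power_one_over)
  qed
  finally have Q: "integral\<^sup>L coin Q \<le> C * sum \<mu> V" using energy by simp
  have "\<epsilon> * sum \<mu> V \<le> (\<Sum>v\<in>V. \<mu> v * measure coin {b. forced (A v) b \<in> E})"
    unfolding sum_distrib_left mult.commute[of \<epsilon>] by (intro sum_mono mult_left_mono likely pos)
  \<comment> \<open>The factor \<open>2 ^ card (A v)\<close> normalises the measure of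
    \<open>E \<inter> S v\<close> to the probability of \<open>E\<close> given \<open>S v\<close>,
    which is that of \<open>E\<close> after forcing \<open>A v\<close>.\<close>
  also have "\<dots> = (\<Sum>v\<in>V. \<mu> v * 2 ^ card (A v) * measure coin (E \<inter> S v))"
    using E by (intro sum.cong refl) (simp add: coin_forced fin S_def Int_def)
  also have "\<dots> = integral\<^sup>L coin T"
    unfolding T_def
    by (subst Bochner_Integration.integral_sum, intro integrable_mult_right int_ind sets.Int S E, assumption+, simp)
  also have "\<dots> \<le> integral\<^sup>L coin (\<lambda>b. (\<epsilon> / C * Q b + C / \<epsilon> * indicator E b) / 2)"
  proof (rule integral_mono[OF intT])
    show "integrable coin (\<lambda>b. (\<epsilon> / C * Q b + C / \<epsilon> * indicator E b) / 2)"
      using intQ int_ind[OF E] by simp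
    fix b
    \<comment> \<open>With these weights the second moment contributes at most half of
      \<open>\<epsilon> * sum \<mu> V\<close>, which the left hand side absorbs.\<close>
    have "0 \<le> (\<epsilon> / C * Z b - indicator E b)\<^sup>2 * (C / \<epsilon>)"
      using \<open>0 < \<epsilon>\<close> \<open>0 < C\<close> by simp
    also have "\<dots> = \<epsilon> / C * (Z b)\<^sup>2 - 2 * (Z b * indicator E b) + C / \<epsilon> * indicator E b"
      using \<open>0 < \<epsilon>\<close> \<open>0 < C\<close>
      by (cases "b \<in> E") (simp_all add: power2_eq_square field_simps)
    finally show "T b \<le> (\<epsilon> / C * Q b + C / \<epsilon> * indicator E b) / 2"
      unfolding Z2 ZE by simp
  qed
  also have "\<dots> = (\<epsilon> / C * integral\<^sup>L coin Q + C / \<epsilon> * measure coin E) / 2"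
    using intQ int_ind[OF E] E by simp
  also have "\<dots> \<le> (\<epsilon> / C * (C * sum \<mu> V) + C / \<epsilon> * measure coin E) / 2"
    using Q \<open>0 < \<epsilon>\<close> \<open>0 < C\<close> by (intro divide_right_mono add_right_mono mult_left_mono) auto
  finally have "\<epsilon> * sum \<mu> V \<le> (\<epsilon> * sum \<mu> V + C / \<epsilon> * measure coin E) / 2"
    using \<open>0 < C\<close> by simp
  then have "\<epsilon> * sum \<mu> V \<le> C / \<epsilon> * measure coin E" by simp
  then show ?thesis using \<open>0 < \<epsilon>\<close> by (simp add: field_simps power2_eq_square)
qed

section \<open>Bit strings as numbers, and counting of outcomes\<close>

lemma bit_sum_exists:
  fixes b :: "nat \<Rightarrow> bool"
  shows "\<exists>r<2 ^ s. \<forall>i<s. bit (r::nat) i = b i"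
proof (intro exI conjI allI impI)
  let ?r = "horner_sum of_bool 2 (map b [0..<s]) :: nat"
  show "?r < 2 ^ s" using horner_sum_of_bool_2_less[of "map b [0..<s]", where 'a = nat]
    by simp
  show "bit ?r i = b i" if "i < s" for i
    using that by (simp add: bit_horner_sum_bit_iff)
qed

lemma bit_nat_eqI:
  fixes r r' :: nat
  assumes "r < 2 ^ s" "r' < 2 ^ s" "\<And>i. i < s \<Longrightarrow> bit r i = bit r' i"
  shows "r = r'"
  using assms bit_take_bit_iff[of s r] bit_take_bit_iff[of s r']
  by (metis bit_eqI take_bit_nat_eq_self_iff)

text \<open>Turns the probability of an event that depends on the first \<open>s\<close> tosses into
  a count over numbers below \<open>2 ^ s\<close>, so that it can be compared computably.\<close>

lemma coin_count:
  assumes dep: "\<And>b b'. (\<And>i. i < s \<Longrightarrow> b i = b' i) \<Longrightarrow> b \<in> E \<longleftrightarrow> b' \<in> E"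
  shows "measure coin E = real (card {r. r < 2 ^ s \<and> bit (r::nat) \<in> E}) / 2 ^ s"
proof -
  let ?R = "{r. r < 2 ^ s \<and> bit (r::nat) \<in> E}"
  let ?B = "\<lambda>r. {b. \<forall>i\<in>{..<s}. b i = bit (r::nat) i}"
  have E: "E = (\<Union>r\<in>?R. ?B r)"
  proof (intro set_eqI iffI)
    fix b assume "b \<in> E"
    obtain r :: nat where r: "r < 2 ^ s" "\<forall>i<s. bit r i = b i" using bit_sum_exists by blast
    then have "bit r \<in> E" using \<open>b \<in> E\<close> dep[of "bit r" b] by blast
    with r show "b \<in> (\<Union>r\<in>?R. ?B r)" by auto
  next
    fix b assume "b \<in> (\<Union>r\<in>?R. ?B r)"
    then obtain r where "r \<in> ?R" "b \<in> ?B r" by blast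
    then have "bit r \<in> E" "\<forall>i<s. b i = bit r i" by auto
    then show "b \<in> E" using dep[of b "bit r"] by blast
  qed
  have fin: "finite ?R" by simp
  have "measure coin (\<Union>r\<in>?R. ?B r) = (\<Sum>r\<in>?R. measure coin (?B r))"
  proof (rule coin.P.finite_measure_finite_Union[OF fin])
    show "?B ` ?R \<subseteq> sets coin" by (auto intro!: sets_prescribed)
    show "disjoint_family_on ?B ?R"
      unfolding disjoint_family_on_def
    proof (intro ballI impI)
      fix r r' assume r: "r \<in> ?R" "r' \<in> ?R" "r \<noteq> r'"
      show "?B r \<inter> ?B r' = {}"
      proof (rule ccontr)
        assume "?B r \<inter> ?B r' \<noteq> {}"
        then obtain b where "\<forall>i<s. b i = bit r i" "\<forall>i<s. b i = bit r' i" by auto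
        then show False using r bit_nat_eqI[of r s r'] by simp
      qed
    qed
  qed
  also have "\<dots> = (\<Sum>r\<in>?R. 1 / 2 ^ s)"
    by (intro sum.cong refl) (simp add: coin_prescribed power_one_over)
  finally show "measure coin E = real (card ?R) / 2 ^ s" using E by simp
qed

section \<open>Cylinders and open sets under the coin measure\<close>

lemma sets_cylinder [intro]: "cylinder w \<in> sets coin"
  using sets_prescribed[of "{..<length w}" "\<lambda>i. w ! i"] by (simp add: cylinder_def lessThan_def)

lemma sets_open_of [intro]: "open_of V \<in> sets coin"
  unfolding open_of_def by (intro sets.countable_UN') auto

lemma coin_cylinder: "measure coin (cylinder w) = (1/2) ^ length w"
  using coin_prescribed[of "{..<length w}" "\<lambda>i. w ! i"] by (simp add: cylinder_def lessThan_def)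

text \<open>For exponent \<open>1\<close> the weight of a string is the measure of its cylinder, and
  the union bound applies. Finite sets \<open>F\<close> are what the stages of a test
  provide.\<close>

lemma coin_open_of_le:
  assumes "finite F" "F \<subseteq> U" "wt 1 U \<le> ennreal d" "0 \<le> d"
  shows "measure coin (open_of F) \<le> d"
proof -
  have "measure coin (open_of F) \<le> (\<Sum>w\<in>F. measure coin (cylinder w))"
    unfolding open_of_def using assms(1) by (intro coin.P.finite_measure_subadditive_finite) auto
  also have "\<dots> = (\<Sum>w\<in>F. 2 powr (- (real (length w) * 1)))"
    by (simp add: coin_cylinder powr_minus powr_realpow power_one_over inverse_eq_divide)
  finally have "ennreal (measure coin (open_of F)) \<le> ennreal (\<Sum>w\<in>F. 2 powr (- (real (length w) * 1)))"
    by (rule ennreal_leI)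
  also have "\<dots> = (\<Sum>w\<in>F. ennreal (2 powr (- (real (length w) * 1))))"
    by (simp add: sum_ennreal)
  also have "\<dots> = (\<Sum>\<^sub>\<infinity>w\<in>F. ennreal (2 powr (- (real (length w) * 1))))"
    using assms(1) by simp
  also have "\<dots> \<le> wt 1 U"
    unfolding wt_def using assms(2) by (intro infsum_mono_neutral nonneg_summable_on_complete) auto
  finally show ?thesis using assms(3,4) by (meson ennreal_le_iff order_trans)
qed

section \<open>The greedy mass distribution\<close>

text \<open>Least significant bit first, so that passing to a prefix of a string becomes
  \<open>take_bit\<close> on its number.\<close>

definition bits :: "nat \<Rightarrow> nat \<Rightarrow> bool list" where
  "bits m t = map (bit t) [0..<m]"

lemma length_bits [simp]: "length (bits m t) = m"
  by (simp add: bits_def)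

lemma nth_bits [simp]: "i < m \<Longrightarrow> bits m t ! i = bit t i"
  by (simp add: bits_def)

lemma bits_surj: "\<exists>t<2 ^ length w. bits (length w) t = w"
proof -
  obtain t :: nat where "t < 2 ^ length w" "\<forall>i<length w. bit t i = w ! i"
    using bit_sum_exists by blast
  then show ?thesis by (intro exI[of _ t]) (auto intro: nth_equalityI)
qed

lemma bits_eq_iff:
  "u < 2 ^ m \<Longrightarrow> u' < 2 ^ m' \<Longrightarrow> bits m u = bits m' u' \<longleftrightarrow> m = m' \<and> u = u'"
proof safe
  assume u: "u < 2 ^ m" "u' < 2 ^ m'" and eq: "bits m u = bits m' u'"
  show m: "m = m'" using arg_cong[OF eq, of length] by simp
  have "bit u i = bit u' i" if "i < m" for i
    using arg_cong[OF eq, of "\<lambda>w. w ! i"] that m by simp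
  then show "u = u'" using u m by (intro bit_nat_eqI[of u m]) auto
qed

lemma string_code_inject [simp]: "string_code v = string_code w \<longleftrightarrow> v = w"
  by (auto simp: string_code_def list_encode_eq inj_map_eq_map inj_def)

lemma recin_string_code_bits [recin_intros]:
  assumes "recursive_in x m" "recursive_in x t"
  shows "recursive_in x (\<lambda>e. string_code (bits (m e) (t e)))"
  unfolding string_code_def bits_def map_map comp_def
  by (intro recin_intros recin_comp[OF assms(2)] assms)

text \<open>The bound \<open>m < s\<close> makes a stage finite and its open set dependent on the
  positions below \<open>s\<close> alone; for increasing \<open>D\<close> no string is lost in the
  union over all stages.\<close>

definition approx :: "(nat \<Rightarrow> nat \<Rightarrow> nat \<Rightarrow> bool) \<Rightarrow> nat \<Rightarrow> nat \<Rightarrow> bool list set" where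
  "approx D n s = {bits m t |m t. m < s \<and> t < 2 ^ m \<and> D n (string_code (bits m t)) s}"

lemma finite_approx: "finite (approx D n s)"
proof -
  have "approx D n s \<subseteq> (\<lambda>(m, t). bits m t) ` (SIGMA m:{..<s}. {..<2 ^ m})"
    unfolding approx_def by auto
  then show ?thesis by (rule finite_subset) auto
qed

lemma approx_mono:
  assumes "\<And>n c s t. D n c s \<Longrightarrow> s \<le> t \<Longrightarrow> D n c t" "s \<le> t'"
  shows "approx D n s \<subseteq> approx D n t'"
proof
  fix w assume "w \<in> approx D n s"
  then obtain m t where "w = bits m t" "m < s" "t < 2 ^ m" "D n (string_code (bits m t)) s"
    unfolding approx_def by blast
  then show "w \<in> approx D n t'" using assms(1)[OF _ assms(2)] assms(2)
    unfolding approx_def mem_Collect_eq by (intro exI[of _ m] exI[of _ t]) auto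
qed

lemma UN_approx:
  assumes "\<And>n c s t. D n c s \<Longrightarrow> s \<le> t \<Longrightarrow> D n c t"
    and "\<And>w. w \<in> U \<longleftrightarrow> (\<exists>s. D n (string_code w) s)"
  shows "(\<Union>s. approx D n s) = U"
proof (intro set_eqI iffI)
  fix w assume "w \<in> U"
  then obtain s where s: "D n (string_code w) s" using assms(2) by blast
  obtain t where t: "t < 2 ^ length w" "bits (length w) t = w" using bits_surj by blast
  have "D n (string_code w) (max s (Suc (length w)))" using assms(1)[OF s] by simp
  then have "w \<in> approx D n (max s (Suc (length w)))"
    unfolding approx_def mem_Collect_eq using t
    by (intro exI[of _ "length w"] exI[of _ t]) auto
  then show "w \<in> (\<Union>s. approx D n s)" by blast
next
  fix w assume "w \<in> (\<Union>s. approx D n s)"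
  then show "w \<in> U" using assms(2) unfolding approx_def by auto
qed

lemma open_of_approx_iff:
  "b \<in> open_of (approx D n s) \<longleftrightarrow>
    (\<exists>m<s. \<exists>t<2 ^ m. D n (string_code (bits m t)) s \<and> (\<forall>i<m. bit t i = b i))"
proof -
  have "b \<in> open_of (approx D n s) \<longleftrightarrow>
      (\<exists>m t. m < s \<and> t < 2 ^ m \<and> D n (string_code (bits m t)) s \<and> b \<in> cylinder (bits m t))"
    unfolding open_of_def approx_def by blast
  moreover have "b \<in> cylinder (bits m t) \<longleftrightarrow> (\<forall>i<m. bit t i = b i)" for m t
    by (auto simp: cylinder_def)
  ultimately show ?thesis by auto
qed

lemma open_of_approx_local:
  assumes "\<And>i. i < s \<Longrightarrow> b i = b' i"
  shows "b \<in> open_of (approx D n s) \<longleftrightarrow> b' \<in> open_of (approx D n s)"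
proof -
  have "(\<forall>i<m. bit t i = b i) \<longleftrightarrow> (\<forall>i<m. bit t i = b' i)" if "m < s" for m and t :: nat
    using assms that by (meson less_trans)
  then show ?thesis unfolding open_of_approx_iff by blast
qed

text \<open>A node code \<open>c\<close> is a pair of the depth \<open>l\<close> and the label \<open>t < 2 ^ (k * l)\<close> and stands for the string
  \<open>bits (k * l) t\<close>; its prefix at depth \<open>j\<close> has the label \<open>take_bit (k * j) t\<close>.\<close>

abbreviation (input) depth :: "nat \<Rightarrow> nat" where "depth c \<equiv> fst (prod_decode c)"
abbreviation (input) label :: "nat \<Rightarrow> nat" where "label c \<equiv> snd (prod_decode c)"

text \<open>A leading one at position \<open>k * j\<close> marks the length, so prefixes of
  different lengths get different numbers when \<open>k\<close> is positive.\<close>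

definition vertex :: "nat \<Rightarrow> nat \<Rightarrow> nat \<Rightarrow> nat" where
  "vertex k t j = 2 ^ (k * j) + take_bit (k * j) t"

text \<open>What a node contributes to the set of initial segments: the codes of its prefixes whose
  length is a multiple of \<open>k\<close>, from the empty string to the node itself.\<close>

definition chain :: "nat \<Rightarrow> nat \<Rightarrow> nat set" where
  "chain k c = vertex k (label c) ` {..depth c}"

lemma finite_chain [simp]: "finite (chain k c)"
  by (simp add: chain_def)

text \<open>Codes of depth \<open>j\<close> are at least \<open>2 ^ (k * j)\<close> and less than
  \<open>2 ^ Suc (k * j)\<close>; for positive \<open>k\<close> these ranges are disjoint.\<close>

lemma vertex_eq_iff:
  assumes "0 < k"
  shows "vertex k t j = vertex k t' j' \<longleftrightarrow> j = j' \<and> take_bit (k * j) t = take_bit (k * j) t'"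
proof -
  have lt: "take_bit m t < 2 ^ m" for m and t :: nat by simp
  have neq: "vertex k t j \<noteq> vertex k t' j'" if "j < j'" for j j' t t'
  proof -
    have "vertex k t j < 2 ^ Suc (k * j)" using lt[of "k * j" t] by (simp add: vertex_def)
    also have "\<dots> \<le> 2 ^ (k * j')"
    proof (rule power_increasing)
      have "k * Suc j \<le> k * j'" using that by (intro mult_le_mono) auto
      then show "Suc (k * j) \<le> k * j'" using assms by simp
    qed simp
    finally show ?thesis by (simp add: vertex_def)
  qed
  show ?thesis
    using neq[of j j' t t'] neq[of j' j t' t]
    by (cases j j' rule: linorder_cases) (auto simp: vertex_def)
qed

lemma le_vertex:
  assumes "0 < k" shows "j < vertex k t j"
proof -
  have "j \<le> k * j" using assms by simp
  also have "\<dots> < 2 ^ (k * j)" by simp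
  finally show ?thesis by (simp add: vertex_def)
qed

text \<open>A comparison of a probability with \<open>(1/2) ^ e\<close>, cleared of denominators and
  written with bounded quantifiers so that it is visibly recursive; the sum runs over the outcomes
  \<open>r\<close> of the first \<open>s\<close> tosses.\<close>

definition likely :: "nat \<Rightarrow> (nat \<Rightarrow> nat \<Rightarrow> nat \<Rightarrow> bool) \<Rightarrow> nat \<Rightarrow> nat \<Rightarrow> nat \<Rightarrow> nat \<Rightarrow> bool" where
  "likely k D e n c s \<longleftrightarrow>
    2 ^ s < 2 ^ e * (\<Sum>r<2 ^ s. of_bool (\<exists>m<s. \<exists>t<2 ^ m. D n (string_code (bits m t)) s \<and>
      (\<forall>i<m. bit t i = (bit (r::nat) i \<or> (\<exists>j\<le>depth c. i = vertex k (label c) j)))) :: nat)"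

text \<open>All strings of stage \<open>s\<close> are shorter than \<open>s\<close>, so the event is
  decided by the first \<open>s\<close> tosses and \<open>coin_count\<close> applies.\<close>

lemma likely_iff:
  "likely k D e n c s \<longleftrightarrow>
    (1/2) ^ e < measure coin {b. forced (chain k c) b \<in> open_of (approx D n s)}"
proof -
  let ?E = "{b. forced (chain k c) b \<in> open_of (approx D n s)}"
  have local: "b \<in> ?E \<longleftrightarrow> b' \<in> ?E" if "\<And>i. i < s \<Longrightarrow> b i = b' i" for b b'
    using open_of_approx_local[of s "forced (chain k c) b" "forced (chain k c) b'" D n] that
    by (simp add: forced_def)
  have E: "bit r \<in> ?E \<longleftrightarrow> (\<exists>m<s. \<exists>t<2 ^ m. D n (string_code (bits m t)) s \<and>
      (\<forall>i<m. bit t i = (bit r i \<or> (\<exists>j\<le>depth c. i = vertex k (label c) j))))" for r :: nat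
    unfolding mem_Collect_eq open_of_approx_iff forced_def chain_def image_iff Bex_def atMost_iff ..
  let ?R = "{r. r < 2 ^ s \<and> bit (r::nat) \<in> ?E}"
  have "(\<Sum>r<2 ^ s. of_bool (bit (r::nat) \<in> ?E) :: nat) = card ?R"
    by (simp add: of_bool_def sum.If_cases Int_def lessThan_def)
  then have "likely k D e n c s \<longleftrightarrow> 2 ^ s < 2 ^ e * card ?R"
    unfolding likely_def E by simp
  also have "\<dots> \<longleftrightarrow> real (2 ^ s) < real (2 ^ e * card ?R)" by (simp only: of_nat_less_iff)
  also have "\<dots> \<longleftrightarrow> (1/2) ^ e < real (card ?R) / 2 ^ s"
    by (simp add: field_simps power_one_over)
  finally show ?thesis using coin_count[of s ?E, OF local] by simp
qed

section \<open>Mass carried by a finite set of nodes\<close>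

definition mass :: "nat \<Rightarrow> nat set \<Rightarrow> nat \<Rightarrow> nat \<Rightarrow> real" where
  "mass k S j u = (\<Sum>c\<in>S. if j \<le> depth c \<and> take_bit (k * j) (label c) = u then (1/4) ^ depth c else 0)"

text \<open>A node of depth \<open>j\<close> alone carries the threshold \<open>(1/4) ^ j\<close>,
  so every enumerated node saturates itself.\<close>

definition saturated :: "nat \<Rightarrow> nat set \<Rightarrow> nat \<Rightarrow> nat \<Rightarrow> bool" where
  "saturated k S j u \<longleftrightarrow> (1/4) ^ j \<le> mass k S j u"

lemma mass_mono: "finite T \<Longrightarrow> S \<subseteq> T \<Longrightarrow> mass k S j u \<le> mass k T j u"
  unfolding mass_def by (rule sum_mono2) auto

lemma set_decode_less: "c \<in> set_decode m \<Longrightarrow> c < m"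
proof -
  assume "c \<in> set_decode m"
  then have "2 ^ c \<le> m" by (cases "m < 2 ^ c") (auto simp: set_decode_def)
  then show ?thesis using less_exp[of c] by linarith
qed

lemma depth_le: "depth c \<le> c"
  using le_prod_encode_1[of "depth c" "label c"] by simp

text \<open>Multiplying by \<open>4 ^ (m + j)\<close> turns the masses into integers, as \<open>depth c \<le> c < m\<close>
  for all \<open>c \<in> set_decode m\<close>.\<close>

lemma saturated_nat:
  "saturated k (set_decode m) j u \<longleftrightarrow>
    4 ^ m \<le> (\<Sum>c<m. if c \<in> set_decode m \<and> j \<le> depth c \<and> take_bit (k * j) (label c) = u
      then 4 ^ (m + j - depth c) else 0 :: nat)" (is "_ \<longleftrightarrow> 4 ^ m \<le> ?N")
proof -
  have "real ?N = (\<Sum>c<m. if c \<in> set_decode m then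
      (if j \<le> depth c \<and> take_bit (k * j) (label c) = u then 4 ^ (m + j) * (1/4) ^ depth c else 0) else 0)"
    unfolding of_nat_sum
  proof (intro sum.cong refl)
    fix c assume "c \<in> {..<m}"
    then have "depth c \<le> m + j" using depth_le[of c] by simp
    then have "(4::real) ^ (m + j - depth c) = 4 ^ (m + j) * (1/4) ^ depth c"
      by (simp add: power_diff power_one_over field_simps)
    then show "real (if c \<in> set_decode m \<and> j \<le> depth c \<and> take_bit (k * j) (label c) = u
        then 4 ^ (m + j - depth c) else 0) = (if c \<in> set_decode m then
        (if j \<le> depth c \<and> take_bit (k * j) (label c) = u then 4 ^ (m + j) * (1/4) ^ depth c else 0) else 0)"
      by simp
  qed
  also have "\<dots> = (\<Sum>c\<in>set_decode m. if j \<le> depth c \<and> take_bit (k * j) (label c) = u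
      then 4 ^ (m + j) * (1/4) ^ depth c else 0)"
    using set_decode_less by (subst sum.inter_restrict[symmetric]) (auto intro!: sum.cong)
  also have "\<dots> = 4 ^ (m + j) * mass k (set_decode m) j u"
    unfolding mass_def sum_distrib_left by (intro sum.cong) auto
  finally have N: "real ?N = 4 ^ (m + j) * mass k (set_decode m) j u" .
  have "4 ^ m \<le> ?N \<longleftrightarrow> real (4 ^ m) \<le> real ?N" by (simp only: of_nat_le_iff)
  also have "\<dots> \<longleftrightarrow> (4::real) ^ (m + j) * (1/4) ^ j \<le> 4 ^ (m + j) * mass k (set_decode m) j u"
    unfolding N by (simp add: power_add power_one_over)
  also have "\<dots> \<longleftrightarrow> saturated k (set_decode m) j u"
    by (simp add: saturated_def)
  finally show ?thesis ..
qed

text \<open>The number \<open>z\<close> codes a pair of a node and a stage, so each pair is examined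
  exactly once. The current set of nodes is kept as the bits of \<open>m\<close>, which makes the
  enumeration a recursion on numbers.\<close>

definition grow :: "nat \<Rightarrow> (nat \<Rightarrow> nat \<Rightarrow> nat \<Rightarrow> bool) \<Rightarrow> nat \<Rightarrow> nat \<Rightarrow> nat \<Rightarrow> nat \<Rightarrow> nat" where
  "grow k D e n z m =
    (if label (fst (prod_decode z)) < 2 ^ (k * depth (fst (prod_decode z))) \<and>
        likely k D e n (fst (prod_decode z)) (snd (prod_decode z)) \<and>
        (\<forall>j\<le>depth (fst (prod_decode z)).
          \<not> saturated k (set_decode m) j (take_bit (k * j) (label (fst (prod_decode z)))))
     then m + 2 ^ fst (prod_decode z) else m)"

definition nodes :: "nat \<Rightarrow> (nat \<Rightarrow> nat \<Rightarrow> nat \<Rightarrow> bool) \<Rightarrow> nat \<Rightarrow> nat \<Rightarrow> nat \<Rightarrow> nat" where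
  "nodes k D e n = rec_nat 0 (grow k D e n)"

lemma nodes_simps [simp]:
  "nodes k D e n 0 = 0" "nodes k D e n (Suc z) = grow k D e n z (nodes k D e n z)"
  by (simp_all add: nodes_def)

lemma mass_insert:
  "finite S \<Longrightarrow> c \<notin> S \<Longrightarrow> mass k (insert c S) j u =
    mass k S j u + (if j \<le> depth c \<and> take_bit (k * j) (label c) = u then (1/4) ^ depth c else 0)"
  by (simp add: mass_def)

lemma saturated_self:
  assumes "finite S" "c \<in> S"
  shows "saturated k S (depth c) (take_bit (k * depth c) (label c))"
proof -
  have "mass k {c} (depth c) (take_bit (k * depth c) (label c)) \<le>
      mass k S (depth c) (take_bit (k * depth c) (label c))"
    using assms by (intro mass_mono) auto
  then show ?thesis by (simp add: saturated_def mass_def)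
qed

text \<open>A node already present is saturated at its own depth and thus rejected, so the addition
  of \<open>2 ^ c\<close> always sets a bit that was clear.\<close>

lemma grow_cases:
  obtains (same) "grow k D e n z m = m"
  | (add) c s where "z = prod_encode (c, s)" "label c < 2 ^ (k * depth c)" "likely k D e n c s"
      "\<And>j. j \<le> depth c \<Longrightarrow> \<not> saturated k (set_decode m) j (take_bit (k * j) (label c))"
      "c \<notin> set_decode m" "set_decode (grow k D e n z m) = insert c (set_decode m)"
proof -
  obtain c s where z: "z = prod_encode (c, s)" by (metis prod_decode_inverse surj_pair)
  show thesis
  proof (cases "grow k D e n z m = m")
    case False
    then have *: "label c < 2 ^ (k * depth c)" "likely k D e n c s"
      "\<And>j. j \<le> depth c \<Longrightarrow> \<not> saturated k (set_decode m) j (take_bit (k * j) (label c))"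
      and g: "grow k D e n z m = m + 2 ^ c"
      unfolding grow_def z by (auto split: if_splits)
    have c: "c \<notin> set_decode m" using saturated_self[of "set_decode m" c k] *(3) by auto
    have "set_decode (grow k D e n z m) = insert c (set_decode m)"
      unfolding g using set_decode_plus_power_2[OF c] by (simp add: add.commute)
    with * c z show thesis by (intro add)
  qed (rule same)
qed

lemma nodes_mono: "z \<le> z' \<Longrightarrow> set_decode (nodes k D e n z) \<subseteq> set_decode (nodes k D e n z')"
proof (induction z' rule: dec_induct)
  case (step z')
  show ?case
    using step.IH by (cases rule: grow_cases[of k D e n z' "nodes k D e n z'"]) auto
qed simp

text \<open>The bound \<open>s \<le> z\<close> lets one open set, that of stage \<open>z\<close>,
  serve for all nodes at once.\<close>

lemma nodes_likely:
  "c \<in> set_decode (nodes k D e n z) \<Longrightarrow> \<exists>s\<le>z. likely k D e n c s"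
proof (induction z)
  case (Suc z)
  show ?case
  proof (cases rule: grow_cases[of k D e n z "nodes k D e n z"])
    case same
    then show ?thesis using Suc by (auto intro: le_SucI)
  next
    case (add c' s)
    have "s \<le> z" unfolding add(1) by (rule le_prod_encode_2)
    then show ?thesis using add Suc by (auto intro: le_SucI)
  qed
qed simp

text \<open>A node is added only while all its prefixes are unsaturated, and it brings at most
  \<open>(1/4) ^ j\<close> to its prefix at depth \<open>j\<close>: the threshold is overshot by at
  most a factor of two.\<close>

lemma mass_nodes: "mass k (set_decode (nodes k D e n z)) j u \<le> 2 * (1/4) ^ j"
proof (induction z)
  case (Suc z)
  show ?case
  proof (cases rule: grow_cases[of k D e n z "nodes k D e n z"])
    case (add c s)
    show ?thesis
    proof (cases "j \<le> depth c \<and> take_bit (k * j) (label c) = u")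
      case True
      then have "mass k (set_decode (nodes k D e n z)) j u < (1/4) ^ j"
        using add(4)[of j] by (simp add: saturated_def)
      moreover have "(1/4 :: real) ^ depth c \<le> (1/4) ^ j" using True by (intro power_decreasing) auto
      ultimately have "mass k (set_decode (nodes k D e n z)) j u + (1/4) ^ depth c \<le> 2 * (1/4) ^ j"
        by linarith
      then show ?thesis using True by (simp add: add(6) mass_insert[OF finite_set_decode add(5)])
    next
      case False
      show ?thesis
        unfolding nodes_simps add(6) mass_insert[OF finite_set_decode add(5)] if_not_P[OF False]
        using Suc by simp
    qed
  qed (use Suc in simp)
qed (simp add: mass_def)

section \<open>Energy and total mass of the greedy distribution\<close>

lemma sum_half_le: "(\<Sum>j\<le>l. (1/2) ^ j) \<le> (2::real)"
proof -
  have "(\<Sum>j\<le>l. (1/2) ^ j) = (2::real) - (1/2) ^ l" for l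
    by (induction l) simp_all
  then show ?thesis by simp
qed

text \<open>The term of \<open>Max J\<close> suffices, as \<open>card J \<le> Suc (Max J)\<close>.
  This replaces an exponential in the number of common prefixes by a sum over their depths, which
  can be exchanged with the sum over nodes.\<close>

lemma two_power_card_le:
  fixes J :: "nat set"
  assumes "finite J" "J \<noteq> {}"
  shows "(2::real) ^ card J \<le> (\<Sum>j\<in>J. 2 ^ Suc j)"
proof -
  have "J \<subseteq> {..Max J}" using assms by auto
  then have "card J \<le> Suc (Max J)" using card_mono[of "{..Max J}" J] by simp
  then have "(2::real) ^ card J \<le> 2 ^ Suc (Max J)" by (intro power_increasing) auto
  also have "\<dots> \<le> (\<Sum>j\<in>J. 2 ^ Suc j)"
    using assms by (intro member_le_sum[of "Max J" J "\<lambda>j. (2::real) ^ Suc j"]) auto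
  finally show ?thesis .
qed

text \<open>Fix \<open>v\<close> and sort the nodes \<open>w\<close> by their common prefixes with
  \<open>v\<close>. Those agreeing with \<open>v\<close> up to depth \<open>j\<close> have mass at
  most \<open>2 * (1/4) ^ j\<close> and enter with factor \<open>2 ^ Suc j\<close>, so each depth
  contributes at most \<open>4 * (1/2) ^ j\<close>, and all depths together at most
  \<open>8\<close>.\<close>

lemma energy_le:
  assumes "0 < k" "finite S" "\<And>j u. mass k S j u \<le> 2 * (1/4) ^ j"
  shows "(\<Sum>v\<in>S. \<Sum>w\<in>S. (1/4) ^ depth v * (1/4) ^ depth w * 2 ^ card (chain k v \<inter> chain k w))
    \<le> 8 * (\<Sum>v\<in>S. (1/4 :: real) ^ depth v)"
  unfolding sum_distrib_left
proof (rule sum_mono)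
  fix v assume "v \<in> S"
  define J where "J w = {j. j \<le> depth v \<and> j \<le> depth w \<and> take_bit (k * j) (label w) = take_bit (k * j) (label v)}" for w
  have J: "finite (J w)" "J w \<noteq> {}" for w
  proof -
    show "finite (J w)" unfolding J_def by (rule finite_subset[of _ "{..depth v}"]) auto
    have "0 \<in> J w" by (simp add: J_def)
    then show "J w \<noteq> {}" by blast
  qed
  have le: "(2::real) ^ card (chain k v \<inter> chain k w) \<le>
      (\<Sum>j\<le>depth v. if j \<le> depth w \<and> take_bit (k * j) (label w) = take_bit (k * j) (label v) then 2 ^ Suc j else 0)" for w
  proof -
    have "chain k v \<inter> chain k w \<subseteq> vertex k (label v) ` J w"
      by (auto simp: chain_def J_def vertex_eq_iff[OF assms(1)])
    then have "card (chain k v \<inter> chain k w) \<le> card (J w)"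
      using J(1) by (meson card_image_le card_mono finite_imageI le_trans)
    then have "(2::real) ^ card (chain k v \<inter> chain k w) \<le> 2 ^ card (J w)" by (intro power_increasing) auto
    also have "\<dots> \<le> (\<Sum>j\<in>J w. 2 ^ Suc j)" by (rule two_power_card_le[OF J])
    also have "\<dots> = (\<Sum>j\<le>depth v. if j \<le> depth w \<and> take_bit (k * j) (label w) = take_bit (k * j) (label v) then 2 ^ Suc j else 0)"
      by (subst sum.inter_filter[symmetric]) (auto simp: J_def intro!: sum.cong)
    finally show ?thesis .
  qed
  have "(\<Sum>w\<in>S. (1/4) ^ depth v * (1/4) ^ depth w * 2 ^ card (chain k v \<inter> chain k w)) \<le>
      (\<Sum>w\<in>S. (1/4 :: real) ^ depth v * (1/4) ^ depth w *
        (\<Sum>j\<le>depth v. if j \<le> depth w \<and> take_bit (k * j) (label w) = take_bit (k * j) (label v) then 2 ^ Suc j else 0))"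
    using le by (intro sum_mono mult_left_mono) auto
  also have "\<dots> = (1/4) ^ depth v * (\<Sum>j\<le>depth v. 2 ^ Suc j * mass k S j (take_bit (k * j) (label v)))"
    unfolding mass_def sum_distrib_left
    by (subst sum.swap) (intro sum.cong refl, simp)
  also have "\<dots> \<le> (1/4) ^ depth v * (\<Sum>j\<le>depth v. 2 ^ Suc j * (2 * (1/4) ^ j))"
    using assms(3) by (intro mult_left_mono sum_mono) auto
  also have "(\<Sum>j\<le>depth v. 2 ^ Suc j * (2 * (1/4) ^ j)) = 4 * (\<Sum>j\<le>depth v. (1/2 :: real) ^ j)"
  proof (unfold sum_distrib_left, intro sum.cong refl)
    show "2 ^ Suc j * (2 * (1/4) ^ j) = 4 * (1/2 :: real) ^ j" for j
      using power_mult_distrib[of "2::real" "1/4" j] by simp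
  qed
  also have "(1/4) ^ depth v * \<dots> \<le> (1/4) ^ depth v * (4 * 2 :: real)"
    by (intro mult_left_mono sum_half_le) auto
  finally show "(\<Sum>w\<in>S. (1/4) ^ depth v * (1/4) ^ depth w * 2 ^ card (chain k v \<inter> chain k w)) \<le>
      8 * (1/4 :: real) ^ depth v" by simp
qed

text \<open>The second moment bound with \<open>\<epsilon> = (1/2) ^ e\<close> and
  \<open>C = 8\<close>, the constant of \<open>energy_le\<close>. The factor \<open>4 ^ e\<close> is
  the inverse square of this \<open>\<epsilon>\<close>.\<close>

lemma total_mass_nodes:
  assumes "0 < k" and mono: "\<And>n c s t. D n c s \<Longrightarrow> s \<le> t \<Longrightarrow> D n c t"
    and small: "\<And>s. measure coin (open_of (approx D n s)) \<le> d"
  shows "(\<Sum>c\<in>set_decode (nodes k D e n z). (1/4) ^ depth c) \<le> 8 * 4 ^ e * d"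
proof -
  let ?S = "set_decode (nodes k D e n z)"
  let ?m = "\<Sum>c\<in>?S. (1/4 :: real) ^ depth c"
  let ?E = "open_of (approx D n z)"
  have subset: "open_of (approx D n s) \<subseteq> ?E" if "s \<le> z" for s
    unfolding open_of_def by (intro UN_mono approx_mono that order_refl) (rule mono)
  have "((1/2) ^ e)\<^sup>2 * ?m \<le> 8 * measure coin ?E"
  proof (rule second_moment[where A = "chain k" and V = ?S and \<mu> = "\<lambda>c. (1/4) ^ depth c" and C = 8])
    fix c assume "c \<in> ?S"
    from nodes_likely[OF this] obtain s where s: "s \<le> z" "likely k D e n c s" by blast
    have "measure coin {b. forced (chain k c) b \<in> open_of (approx D n s)} \<le>
        measure coin {b. forced (chain k c) b \<in> ?E}"
      using subset[OF s(1)] by (intro coin.P.finite_measure_mono sets_forced sets_open_of) auto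
    then show "(1/2) ^ e \<le> measure coin {b. forced (chain k c) b \<in> ?E}"
      using s(2) unfolding likely_iff by simp
  next
    show "(\<Sum>v\<in>?S. \<Sum>w\<in>?S. (1/4) ^ depth v * (1/4) ^ depth w * 2 ^ card (chain k v \<inter> chain k w))
        \<le> 8 * ?m"
      by (rule energy_le[OF assms(1) finite_set_decode mass_nodes])
  qed (rule sets_open_of | simp)+
  also have "\<dots> \<le> 8 * d" using small by simp
  also have "((1/2) ^ e)\<^sup>2 * ?m = (1/4) ^ e * ?m"
    using power_mult_distrib[of "1/2::real" "1/2" e] by (simp add: power2_eq_square)
  finally have "4 ^ e * ((1/4) ^ e * ?m) \<le> 4 ^ e * (8 * d)" by (intro mult_left_mono) auto
  moreover have "4 ^ e * ((1/4) ^ e * ?m) = (4 ^ e * (1/4) ^ e) * ?m" by (simp only: mult.assoc)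
  moreover have "(4::real) ^ e * (1/4) ^ e = 1"
    using power_mult_distrib[of "4::real" "1/4" e] by simp
  ultimately have "?m \<le> 4 ^ e * (8 * d)" by (simp only: mult_1)
  then show ?thesis by (simp only: mult.left_commute mult.assoc)
qed

section \<open>Recursiveness of the greedy enumeration\<close>

lemma recin_app3:
  assumes "recursive_in x (\<lambda>e. F (fst (fst e)) (snd (fst e)) (snd e))" "recursive_in x a" "recursive_in x b" "recursive_in x c"
  shows "recursive_in x (\<lambda>e. F (a e) (b e) (c e))"
  using recin_comp[OF assms(1) recin_Pair[OF recin_Pair[OF assms(2,3)] assms(4)]] by simp

lemma recin_app2:
  assumes "recursive_in x (\<lambda>e. F (fst e) (snd e))" "recursive_in x a" "recursive_in x b"
  shows "recursive_in x (\<lambda>e. F (a e) (b e))"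
  using recin_comp[OF assms(1) recin_Pair[OF assms(2,3)]] by simp

lemma recin_likely:
  assumes "recursive_in x (\<lambda>e. D (fst (fst e)) (snd (fst e)) (snd e))"
  shows "recursive_in x (\<lambda>e. likely k D d (fst (fst e)) (snd (fst e)) (snd e))"
  unfolding likely_def vertex_def by (intro recin_intros recin_app3[OF assms])

lemma recin_saturated:
  "recursive_in x (\<lambda>e. saturated k (set_decode (fst (fst e))) (snd (fst e)) (snd e))"
  unfolding saturated_nat by (intro recin_intros)

lemma recin_nodes:
  assumes "recursive_in x (\<lambda>e. D (fst (fst e)) (snd (fst e)) (snd e))"
  shows "recursive_in x (\<lambda>e. nodes k D d (fst e) (snd e))"
  unfolding nodes_def grow_def
  by (intro recin_rec recin_intros recin_app3[OF recin_likely[OF assms]] recin_app3[OF recin_saturated])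

section \<open>The test covering a non-random real\<close>

text \<open>The shift of the test index by \<open>4 + 2 * d\<close> absorbs the constants of \<open>total_mass_nodes\<close> and of the
  geometric series over the depths.\<close>

definition cover :: "nat \<Rightarrow> (nat \<Rightarrow> nat \<Rightarrow> nat \<Rightarrow> bool) \<Rightarrow> nat \<Rightarrow> nat \<Rightarrow> bool list set" where
  "cover k D d n = {bits (k * j) u |j u. u < 2 ^ (k * j) \<and>
    (\<exists>z. saturated k (set_decode (nodes k D d (n + 4 + 2 * d) z)) j u)}"

lemma uniformly_ce_cover:
  assumes "recursive_in (\<lambda>_. False) (\<lambda>e. D (fst (fst e)) (snd (fst e)) (snd e))"
  shows "uniformly_ce (cover k D d)"
proof -
  \<comment> \<open>The witness \<open>z\<close> codes a number of enumeration steps together with a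
    depth and a label.\<close>
  define Q where "Q n c z \<longleftrightarrow>
    c = string_code (bits (k * fst (prod_decode (snd (prod_decode z)))) (snd (prod_decode (snd (prod_decode z))))) \<and>
    snd (prod_decode (snd (prod_decode z))) < 2 ^ (k * fst (prod_decode (snd (prod_decode z)))) \<and>
    saturated k (set_decode (nodes k D d (n + 4 + 2 * d) (fst (prod_decode z))))
      (fst (prod_decode (snd (prod_decode z)))) (snd (prod_decode (snd (prod_decode z))))" for n c z
  have "recursive_in (\<lambda>_. False) (\<lambda>e. Q (fst (fst e)) (snd (fst e)) (snd e))"
    unfolding Q_def by (intro recin_intros recin_app3[OF recin_saturated] recin_app2[OF recin_nodes[OF assms]])
  then have "uniformly_ce (\<lambda>n. {w. \<exists>z. Q n (string_code w) z})" by (rule uniformly_ce_if_recursive_in)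
  moreover have "{w. \<exists>z. Q n (string_code w) z} = cover k D d n" for n
  proof (intro set_eqI iffI)
    fix w assume "w \<in> cover k D d n"
    then obtain j u z where "w = bits (k * j) u" "u < 2 ^ (k * j)"
      "saturated k (set_decode (nodes k D d (n + 4 + 2 * d) z)) j u" unfolding cover_def by blast
    then have "Q n (string_code w) (prod_encode (z, prod_encode (j, u)))" unfolding Q_def by simp
    then show "w \<in> {w. \<exists>z. Q n (string_code w) z}" by blast
  next
    fix w assume "w \<in> {w. \<exists>z. Q n (string_code w) z}"
    then show "w \<in> cover k D d n" unfolding Q_def cover_def string_code_inject by blast
  qed
  ultimately show ?thesis by simp
qed

text \<open>Saturation gives \<open>(1/8) ^ j \<le> (1/2) ^ j * mass k S j u\<close>. After
  exchanging the sums, a node \<open>c\<close> meets at most one pair of \<open>P\<close> at each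
  depth, and the factors \<open>(1/2) ^ j\<close> add up to at most \<open>2\<close>.\<close>

lemma weight_saturated_le:
  fixes P :: "(nat \<times> nat) set"
  assumes "finite P" "finite S" "\<And>j u. (j, u) \<in> P \<Longrightarrow> saturated k S j u"
  shows "(\<Sum>(j, u)\<in>P. (1/8) ^ j) \<le> 2 * (\<Sum>c\<in>S. (1/4 :: real) ^ depth c)"
proof -
  have "(\<Sum>(j, u)\<in>P. (1/8) ^ j) \<le> (\<Sum>(j, u)\<in>P. (1/2) ^ j * mass k S j u)"
  proof (intro sum_mono, clarify)
    fix j u assume "(j, u) \<in> P"
    then have "(1/2) ^ j * (1/4) ^ j \<le> (1/2) ^ j * mass k S j u"
      using assms(3)[of j u] unfolding saturated_def by (intro mult_left_mono) auto
    then show "(1/8) ^ j \<le> (1/2) ^ j * mass k S j u"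
      using power_mult_distrib[of "1/2::real" "1/4" j] by simp
  qed
  also have "\<dots> = (\<Sum>c\<in>S. (1/4) ^ depth c *
      (\<Sum>(j, u)\<in>P. if j \<le> depth c \<and> take_bit (k * j) (label c) = u then (1/2) ^ j else 0))"
    unfolding mass_def sum_distrib_left split_beta
    by (subst sum.swap) (intro sum.cong refl, simp)
  also have "\<dots> \<le> (\<Sum>c\<in>S. (1/4) ^ depth c * 2)"
  proof (intro sum_mono mult_left_mono)
    fix c
    let ?Q = "{p \<in> P. fst p \<le> depth c \<and> take_bit (k * fst p) (label c) = snd p}"
    have "(\<Sum>(j, u)\<in>P. if j \<le> depth c \<and> take_bit (k * j) (label c) = u then (1/2) ^ j else 0) =
        (\<Sum>p\<in>?Q. (1/2 :: real) ^ fst p)"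
      unfolding split_beta using assms(1) by (rule sum.inter_filter[symmetric])
    also have "\<dots> = (\<Sum>j\<in>fst ` ?Q. (1/2) ^ j)"
      by (rule sum.reindex_cong[symmetric, of fst]) (auto simp: inj_on_def prod_eq_iff)
    also have "\<dots> \<le> (\<Sum>j\<le>depth c. (1/2) ^ j)"
      by (rule sum_mono2) auto
    also have "\<dots> \<le> 2" by (rule sum_half_le)
    finally show "(\<Sum>(j, u)\<in>P. if j \<le> depth c \<and> take_bit (k * j) (label c) = u then (1/2) ^ j else 0)
        \<le> (2::real)" .
  qed simp
  finally show ?thesis by (simp add: sum_distrib_left mult.commute)
qed

lemma saturated_mono:
  "saturated k S j u \<Longrightarrow> finite T \<Longrightarrow> S \<subseteq> T \<Longrightarrow> saturated k T j u"
  unfolding saturated_def using mass_mono[of T S k j u] by linarith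

text \<open>By \<open>3 \<le> real k * \<gamma>\<close>, a string of length \<open>k * j\<close>
  weighs at most \<open>(1/8) ^ j\<close>. It suffices to bound finite parts of the cover, whose
  strings are all saturated at a common step \<open>Z\<close>.\<close>

lemma wt_cover:
  assumes "0 < k" "3 \<le> real k * \<gamma>"
    and mono: "\<And>n c s t. D n c s \<Longrightarrow> s \<le> t \<Longrightarrow> D n c t"
    and small: "\<And>n s. measure coin (open_of (approx D n s)) \<le> 1 / 2 ^ n"
  shows "wt \<gamma> (cover k D d n) \<le> ennreal (1 / 2 ^ n)"
  unfolding wt_def
proof (rule infsum_le_finite_sums)
  show "(\<lambda>w. ennreal (2 powr (- (real (length w) * \<gamma>)))) summable_on cover k D d n"
    by (rule nonneg_summable_on_complete) simp
  fix F assume F: "finite F" "F \<subseteq> cover k D d n"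
  let ?N = "n + 4 + 2 * d"
  have "\<forall>w\<in>F. \<exists>p z. w = bits (k * fst p) (snd p) \<and> saturated k (set_decode (nodes k D d ?N z)) (fst p) (snd p)"
    using F(2) unfolding cover_def by fastforce
  then obtain p z where p: "\<And>w. w \<in> F \<Longrightarrow> w = bits (k * fst (p w)) (snd (p w))"
    and z: "\<And>w. w \<in> F \<Longrightarrow> saturated k (set_decode (nodes k D d ?N (z w))) (fst (p w)) (snd (p w))"
    by metis
  define Z where "Z = (\<Sum>w\<in>F. z w)"
  let ?S = "set_decode (nodes k D d ?N Z)"
  have sat: "saturated k ?S (fst (p w)) (snd (p w))" if "w \<in> F" for w
  proof (rule saturated_mono[OF z[OF that] finite_set_decode nodes_mono])
    show "z w \<le> Z" unfolding Z_def using F(1) that by (intro member_le_sum) auto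
  qed
  have inj: "inj_on p F" using p by (metis inj_onI)
  have "(\<Sum>w\<in>F. 2 powr (- (real (length w) * \<gamma>))) \<le> (\<Sum>w\<in>F. (1/8) ^ fst (p w))"
  proof (rule sum_mono)
    fix w assume "w \<in> F"
    then have len: "length w = k * fst (p w)" using p by (metis length_bits)
    have "real (fst (p w)) * 3 \<le> real (fst (p w)) * (real k * \<gamma>)"
      using assms(2) by (intro mult_left_mono) auto
    then have "2 powr (- (real (length w) * \<gamma>)) \<le> 2 powr (- (3 * real (fst (p w))))"
      unfolding len by (intro powr_mono) (simp_all add: mult_ac)
    also have "\<dots> = (2 powr (- 3)) powr real (fst (p w))" by (simp add: powr_powr)
    also have "(2::real) powr (- 3) = 1/8" by (simp add: powr_minus)
    finally show "2 powr (- (real (length w) * \<gamma>)) \<le> (1/8) ^ fst (p w)" by (simp add: powr_realpow)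
  qed
  also have "\<dots> = (\<Sum>(j, u)\<in>p ` F. (1/8) ^ j)"
    by (simp add: sum.reindex[OF inj] split_beta)
  also have "\<dots> \<le> 2 * (\<Sum>c\<in>?S. (1/4) ^ depth c)"
  proof (rule weight_saturated_le[where k = k])
    show "saturated k ?S j u" if "(j, u) \<in> p ` F" for j u
      using that sat by (metis fst_conv imageE snd_conv)
  qed (use F(1) in simp_all)
  also have "\<dots> \<le> 2 * (8 * 4 ^ d * (1 / 2 ^ ?N))"
    by (intro mult_left_mono total_mass_nodes[OF assms(1)]) (use mono small in auto)
  also have "\<dots> = 1 / 2 ^ n"
    by (simp add: power_add power_mult)
  finally have "(\<Sum>w\<in>F. 2 powr (- (real (length w) * \<gamma>))) \<le> 1 / 2 ^ n" .
  then show "(\<Sum>w\<in>F. ennreal (2 powr (- (real (length w) * \<gamma>)))) \<le> ennreal (1 / 2 ^ n)"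
    by (simp add: sum_ennreal ennreal_leI)
qed

section \<open>The set of initial segments\<close>

definition prefix_val :: "(nat \<Rightarrow> bool) \<Rightarrow> nat \<Rightarrow> nat" where
  "prefix_val x m = horner_sum of_bool 2 (map x [0..<m])"

definition prefix_set :: "nat \<Rightarrow> (nat \<Rightarrow> bool) \<Rightarrow> nat set" where
  "prefix_set k x = range (\<lambda>j. 2 ^ (k * j) + prefix_val x (k * j))"

lemma prefix_val_less: "prefix_val x m < 2 ^ m"
  using horner_sum_of_bool_2_less[of "map x [0..<m]", where 'a = nat] by (simp add: prefix_val_def)

lemma bit_prefix_val: "bit (prefix_val x m) i \<longleftrightarrow> i < m \<and> x i"
  by (auto simp: prefix_val_def bit_horner_sum_bit_iff)

lemma take_bit_prefix_val: "m \<le> m' \<Longrightarrow> take_bit m (prefix_val x m') = prefix_val x m"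
  by (simp add: prefix_val_def take_bit_horner_sum_bit_eq take_map)

lemma vertex_prefix_val:
  "j \<le> l \<Longrightarrow> vertex k (prefix_val x (k * l)) j = 2 ^ (k * j) + prefix_val x (k * j)"
  by (simp add: vertex_def take_bit_prefix_val)

text \<open>Elements of depth \<open>j\<close> exceed \<open>j\<close>, so those below
  \<open>s\<close> come from depths below \<open>s\<close> and already belong to the chain of the
  prefix of depth \<open>s\<close>.\<close>

lemma chain_prefix_val:
  assumes "0 < k" "i < s"
  shows "i \<in> chain k (prod_encode (s, prefix_val x (k * s))) \<longleftrightarrow> i \<in> prefix_set k x"
proof
  assume "i \<in> chain k (prod_encode (s, prefix_val x (k * s)))"
  then show "i \<in> prefix_set k x" by (auto simp: chain_def prefix_set_def vertex_prefix_val)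
next
  assume "i \<in> prefix_set k x"
  then obtain j where j: "i = vertex k (prefix_val x (k * j)) j"
    by (auto simp: prefix_set_def vertex_prefix_val)
  then have "j \<le> s" using le_vertex[OF assms(1), of j "prefix_val x (k * j)"] assms(2) by simp
  then have "i = vertex k (prefix_val x (k * s)) j" using j by (simp add: vertex_prefix_val)
  then show "i \<in> chain k (prod_encode (s, prefix_val x (k * s)))"
    using \<open>j \<le> s\<close> by (auto simp: chain_def)
qed

text \<open>Stage \<open>s\<close> looks only at positions below \<open>s\<close>, where the chain
  and the whole set agree.\<close>

lemma likely_prefix:
  assumes "0 < k" "(1/2) ^ d < measure coin {b. forced (prefix_set k x) b \<in> open_of (approx D n s)}"
  shows "likely k D d n (prod_encode (s, prefix_val x (k * s))) s"
proof -
  have "forced (chain k (prod_encode (s, prefix_val x (k * s)))) b \<in> open_of (approx D n s) \<longleftrightarrow>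
      forced (prefix_set k x) b \<in> open_of (approx D n s)" for b
    using chain_prefix_val[OF assms(1), of _ s x]
    by (intro open_of_approx_local) (simp add: forced_def)
  then show ?thesis using assms(2) unfolding likely_iff by simp
qed

text \<open>When the pair of this node and stage is examined, either some prefix is already
  saturated, or the node is added and saturates itself.\<close>

lemma prefix_saturated:
  assumes "likely k D d n (prod_encode (s, prefix_val x (k * s))) s"
  shows "\<exists>j z. saturated k (set_decode (nodes k D d n z)) j (prefix_val x (k * j))"
proof -
  let ?c = "prod_encode (s, prefix_val x (k * s))"
  let ?z = "prod_encode (?c, s)"
  show ?thesis
  proof (cases "\<exists>j\<le>s. saturated k (set_decode (nodes k D d n ?z)) j (take_bit (k * j) (prefix_val x (k * s)))")
    case True
    then obtain j where j: "j \<le> s"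
      "saturated k (set_decode (nodes k D d n ?z)) j (take_bit (k * j) (prefix_val x (k * s)))" by blast
    then have "take_bit (k * j) (prefix_val x (k * s)) = prefix_val x (k * j)"
      by (intro take_bit_prefix_val) simp
    then show ?thesis using j(2) by auto
  next
    case False
    let ?m = "nodes k D d n ?z"
    have "grow k D d n ?z ?m = ?m + 2 ^ ?c"
      unfolding grow_def using False assms prefix_val_less[of x "k * s"] by simp
    then have "set_decode (nodes k D d n (Suc ?z)) = insert ?c (set_decode ?m)"
      by (cases rule: grow_cases[of k D d n ?z ?m]) auto
    then have "saturated k (set_decode (nodes k D d n (Suc ?z))) s (take_bit (k * s) (prefix_val x (k * s)))"
      using saturated_self[of "set_decode (nodes k D d n (Suc ?z))" ?c k] by simp
    then show ?thesis unfolding take_bit_prefix_val[OF order_refl] by blast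
  qed
qed

text \<open>If the failure probability were positive, a single \<open>d\<close> would serve for all
  levels of the test, and \<open>cover k D d\<close> would capture \<open>x\<close>.\<close>

lemma gamma_random_avoids:
  assumes random: "gamma_random \<gamma> x" and k: "0 < k" "3 \<le> real k * \<gamma>" and test: "ml_test 1 U"
  shows "{b. forced (prefix_set k x) b \<in> (\<Inter>n. open_of (U n))} \<in> null_sets coin"
proof -
  let ?Y = "prefix_set k x"
  let ?G = "{b. forced ?Y b \<in> (\<Inter>n. open_of (U n))}"
  have G: "?G \<in> sets coin" by (intro sets_forced) auto
  have "measure coin ?G = 0"
  proof (rule ccontr)
    assume "measure coin ?G \<noteq> 0"
    then have "0 < measure coin ?G" by (simp add: zero_less_measure_iff)
    then obtain d where d: "(1/2) ^ d < measure coin ?G"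
      using real_arch_pow_inv[of "measure coin ?G" "1/2"] by auto
    have ce: "uniformly_ce U" and wt: "\<And>n. wt 1 (U n) \<le> ennreal (1 / 2 ^ n)"
      using test unfolding ml_test_def by auto
    obtain D :: "nat \<Rightarrow> nat \<Rightarrow> nat \<Rightarrow> bool"
      where D: "\<forall>x. recursive_in x (\<lambda>e. D (fst (fst e)) (snd (fst e)) (snd e))"
      and mono': "\<forall>n c s t. D n c s \<longrightarrow> s \<le> t \<longrightarrow> D n c t"
      and U: "\<forall>n w. w \<in> U n \<longleftrightarrow> (\<exists>s. D n (string_code w) s)"
      using uniformly_ce_stages[OF ce] by (elim exE conjE)
    have mono: "D n c t" if "D n c s" "s \<le> t" for n c s t using mono' that by blast
    have UN: "(\<Union>s. approx D n s) = U n" for n by (rule UN_approx[OF mono]) (use U in auto)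
    have small: "measure coin (open_of (approx D n s)) \<le> 1 / 2 ^ n" for n s
      using UN[of n] by (intro coin_open_of_le[OF finite_approx _ wt]) (blast, simp)
    have "wt \<gamma> (cover k D d n) \<le> ennreal (1 / 2 ^ n)" for n
      by (rule wt_cover[OF k _ small]) (rule mono)
    then have "ml_test \<gamma> (cover k D d)"
      unfolding ml_test_def using uniformly_ce_cover[OF D[rule_format]] by blast
    moreover have "x \<in> open_of (cover k D d n)" for n
    proof -
      let ?N = "n + 4 + 2 * d"
      let ?A = "\<lambda>s. {b. forced ?Y b \<in> open_of (approx D ?N s)}"
      have "open_of (U ?N) = (\<Union>s. open_of (approx D ?N s))"
        unfolding UN[symmetric] open_of_def by blast
      then have "?G \<subseteq> (\<Union>s. ?A s)" by blast
      moreover have A: "range ?A \<subseteq> sets coin" by (auto intro!: sets_forced)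
      ultimately have "measure coin ?G \<le> measure coin (\<Union>s. ?A s)"
        by (intro coin.P.finite_measure_mono) auto
      with d have *: "(1/2) ^ d < measure coin (\<Union>s. ?A s)" by linarith
      have "incseq ?A"
      proof (rule incseq_SucI)
        fix s
        have "approx D ?N s \<subseteq> approx D ?N (Suc s)"
          by (rule approx_mono[where D = D]) (erule mono, simp_all)
        then show "?A s \<subseteq> ?A (Suc s)" unfolding open_of_def by blast
      qed
      \<comment> \<open>By continuity from below, the probability exceeds \<open>(1/2) ^ d\<close>
        already at a finite stage.\<close>
      then have "(\<lambda>s. measure coin (?A s)) \<longlonglongrightarrow> measure coin (\<Union>s. ?A s)"
        by (rule coin.P.finite_Lim_measure_incseq[OF A])
      then have "eventually (\<lambda>s. (1/2) ^ d < measure coin (?A s)) sequentially"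
        using * by (rule order_tendstoD)
      then obtain s where "(1/2) ^ d < measure coin (?A s)"
        by (auto simp: eventually_sequentially)
      then obtain j z where sat: "saturated k (set_decode (nodes k D d ?N z)) j (prefix_val x (k * j))"
        using prefix_saturated[OF likely_prefix[OF k(1)]] by blast
      have "bits (k * j) (prefix_val x (k * j)) \<in> cover k D d n"
        unfolding cover_def using sat prefix_val_less by blast
      moreover have "x \<in> cylinder (bits (k * j) (prefix_val x (k * j)))"
        by (simp add: cylinder_def bit_prefix_val)
      ultimately show ?thesis unfolding open_of_def by blast
    qed
    ultimately show False using random unfolding gamma_random_def by blast
  qed
  then show ?thesis using G by (auto simp: null_sets_def coin.P.emeasure_eq_measure)
qed

section \<open>Countably many tests, and the existence of a random superset\<close>

instance prog :: countable
  by countable_datatype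

text \<open>A test is determined by any program that enumerates it.\<close>

lemma countable_ml_tests: "countable {U. ml_test \<gamma> U}"
proof -
  have "U \<in> range (\<lambda>p n. {w. \<exists>r. run (\<lambda>_. False) p [n, string_code w] r})" if test: "ml_test \<gamma> U" for U
  proof -
    obtain p where "\<And>n w. w \<in> U n \<longleftrightarrow> (\<exists>r. run (\<lambda>_. False) p [n, string_code w] r)"
      using test unfolding ml_test_def uniformly_ce_def by blast
    then have "U = (\<lambda>n. {w. \<exists>r. run (\<lambda>_. False) p [n, string_code w] r})" by blast
    then show ?thesis by (rule range_eqI)
  qed
  then show ?thesis by (intro countable_subset[OF _ countable_image[OF countableI_type]]) auto
qed

lemma random_superset:
  assumes "gamma_random \<gamma> x" "0 < k" "3 \<le> real k * \<gamma>"
  shows "\<exists>R. ml_random (\<lambda>n. n \<in> R) \<and> prefix_set k x \<subseteq> R"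
proof -
  have "AE b in coin. \<forall>U\<in>{U. ml_test 1 U}. forced (prefix_set k x) b \<notin> (\<Inter>n. open_of (U n))"
  proof (subst AE_ball_countable[OF countable_ml_tests], intro ballI)
    fix U assume "U \<in> {U. ml_test 1 U}"
    then have "AE b in coin. b \<notin> {b. forced (prefix_set k x) b \<in> (\<Inter>n. open_of (U n))}"
      using gamma_random_avoids[OF assms] by (intro AE_not_in) auto
    then show "AE b in coin. forced (prefix_set k x) b \<notin> (\<Inter>n. open_of (U n))" by simp
  qed
  \<comment> \<open>A property that no outcome has cannot hold almost surely under a probability
    measure.\<close>
  then have "\<exists>b. \<forall>U\<in>{U. ml_test 1 U}. forced (prefix_set k x) b \<notin> (\<Inter>n. open_of (U n))"
    (is "\<exists>b. ?P b")
  proof (rule contrapos_pp)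
    assume "\<not> (\<exists>b. ?P b)"
    then have P: "?P = (\<lambda>b. False)" by (simp only: not_ex fun_eq_iff simp_thms)
    show "\<not> (AE b in coin. ?P b)" unfolding P coin.P.AE_const by simp
  qed
  then obtain b where "\<forall>U. ml_test 1 U \<longrightarrow> forced (prefix_set k x) b \<notin> (\<Inter>n. open_of (U n))"
    by auto
  then have "ml_random (\<lambda>n. n \<in> {n. forced (prefix_set k x) b n})"
    unfolding ml_random_def gamma_random_def by simp
  moreover have "prefix_set k x \<subseteq> {n. forced (prefix_set k x) b n}"
    by (auto simp: forced_def)
  ultimately show ?thesis by blast
qed

section \<open>Infinitude and truth-table degree of the prefix set\<close>

lemma infinite_prefix_set:
  assumes "0 < k" shows "infinite (prefix_set k x)"
  unfolding prefix_set_def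
proof (rule range_inj_infinite, rule injI)
  fix i j assume "2 ^ (k * i) + prefix_val x (k * i) = 2 ^ (k * j) + prefix_val x (k * j)"
  then have "vertex k (prefix_val x (k * i)) i = vertex k (prefix_val x (k * j)) j"
    by (simp add: vertex_prefix_val)
  then show "i = j" by (simp add: vertex_eq_iff[OF assms])
qed

text \<open>All quantifiers are bounded, and \<open>x\<close> is consulted only below
  \<open>k * j\<close>, which is less than \<open>2 ^ (k * j)\<close> and hence than
  \<open>n\<close>. This form yields both the Turing and the truth-table reduction.\<close>

lemma mem_prefix_set:
  assumes "0 < k"
  shows "n \<in> prefix_set k x \<longleftrightarrow>
    (\<exists>j\<le>n. 2 ^ (k * j) \<le> n \<and> n < 2 * 2 ^ (k * j) \<and> (\<forall>i<k * j. x i = bit n i))"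
proof
  assume "n \<in> prefix_set k x"
  then obtain j where n: "n = 2 ^ (k * j) + prefix_val x (k * j)" by (auto simp: prefix_set_def)
  have "j \<le> n" using le_vertex[OF assms, of j "prefix_val x (k * j)"] n by (simp add: vertex_prefix_val)
  moreover have "x i = bit n i" if "i < k * j" for i
  proof -
    have "take_bit (k * j) n = prefix_val x (k * j)"
      unfolding n take_bit_eq_mod using prefix_val_less[of x "k * j"] by simp
    then have "bit n i \<longleftrightarrow> bit (prefix_val x (k * j)) i" using that by (metis bit_take_bit_iff)
    then show ?thesis using that by (simp add: bit_prefix_val)
  qed
  ultimately show "\<exists>j\<le>n. 2 ^ (k * j) \<le> n \<and> n < 2 * 2 ^ (k * j) \<and> (\<forall>i<k * j. x i = bit n i)"
    using n prefix_val_less[of x "k * j"] by (intro exI[of _ j]) auto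
next
  assume "\<exists>j\<le>n. 2 ^ (k * j) \<le> n \<and> n < 2 * 2 ^ (k * j) \<and> (\<forall>i<k * j. x i = bit n i)"
  then obtain j where j: "2 ^ (k * j) \<le> n" "n < 2 * 2 ^ (k * j)" "\<And>i. i < k * j \<Longrightarrow> x i = bit n i"
    by blast
  then have *: "take_bit (k * j) n = n - 2 ^ (k * j)"
    unfolding take_bit_eq_mod by (subst le_mod_geq) auto
  have "prefix_val x (k * j) = take_bit (k * j) n"
    using j(3) by (intro bit_nat_eqI[of _ "k * j"] prefix_val_less) (auto simp: bit_prefix_val bit_take_bit_iff)
  then have "n = 2 ^ (k * j) + prefix_val x (k * j)" using * j(1) by simp
  then show "n \<in> prefix_set k x" by (auto simp: prefix_set_def)
qed

lemma turing_reducible_prefix_set: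
  assumes "0 < k" shows "(\<lambda>n. n \<in> prefix_set k x) \<le>\<^sub>T x"
  unfolding mem_prefix_set[OF assms]
  by (intro turing_reducible_if_recursive_in recin_intros recin_comp[OF recin_query])

text \<open>The entry \<open>bits (Suc (L n)) 0\<close> below has the wrong length for an answer vector, so it never matches.\<close>

lemma tt_reducible_if_bounded_use:
  assumes L: "recursive_in (\<lambda>_. False) L" and R: "recursive_in (\<lambda>_. False) (\<lambda>e. R (fst e) (snd e))"
    and y: "\<And>n t. t < 2 ^ L n \<Longrightarrow> (\<And>i. i < L n \<Longrightarrow> bit t i = x i) \<Longrightarrow> y n \<longleftrightarrow> R n (t::nat)"
  shows "y \<le>\<^sub>t\<^sub>t x"
proof -
  define f where "f n = prod_encode (list_encode (map (\<lambda>i. i) [0..<L n]),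
    list_encode (map (\<lambda>t. if R n t then string_code (bits (L n) t) else string_code (bits (Suc (L n)) 0))
      [0..<2 ^ L n]))" for n
  have "recursive_in (\<lambda>_. False) f"
    unfolding f_def by (intro recin_intros recin_app2[OF R] recin_comp[OF L])
  then have "computable f" by (rule computable_if_recursive_in)
  moreover have "y n \<longleftrightarrow> tt_satisfies x (f n)" for n
  proof -
    \<comment> \<open>\<open>t0\<close> codes the true answers; of the listed vectors only the entry
      for \<open>t0\<close> itself can match.\<close>
    obtain t0 :: nat where t0: "t0 < 2 ^ L n" "\<forall>i<L n. bit t0 i = x i" using bit_sum_exists by blast
    then have ans: "map x [0..<L n] = bits (L n) t0" by (auto simp: bits_def)
    have "tt_satisfies x (f n) \<longleftrightarrow> (\<exists>t<2 ^ L n. string_code (bits (L n) t0) =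
        (if R n t then string_code (bits (L n) t) else string_code (bits (Suc (L n)) 0)))"
      unfolding tt_satisfies_def f_def by (auto simp: ans image_iff)
    also have "\<dots> \<longleftrightarrow> (\<exists>t<2 ^ L n. R n t \<and> t = t0)"
    proof (intro ex_cong1 conj_cong refl)
      fix t :: nat assume t: "t < 2 ^ L n"
      have "bits (L n) t0 \<noteq> bits (Suc (L n)) 0" by (metis length_bits n_not_Suc_n)
      then show "(string_code (bits (L n) t0) =
        (if R n t then string_code (bits (L n) t) else string_code (bits (Suc (L n)) 0))) \<longleftrightarrow>
        R n t \<and> t = t0"
        using bits_eq_iff[OF t0(1) t] by auto
    qed
    also have "\<dots> \<longleftrightarrow> y n" using y[OF t0(1)] t0 by auto
    finally show ?thesis ..
  qed
  ultimately show ?thesis unfolding tt_reducible_def by blast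
qed

text \<open>Queries below \<open>n\<close> suffice, as a prefix coded by \<open>n\<close> has length
  less than \<open>n\<close>.\<close>

lemma tt_reducible_prefix_set:
  assumes "0 < k" shows "(\<lambda>n. n \<in> prefix_set k x) \<le>\<^sub>t\<^sub>t x"
proof (rule tt_reducible_if_bounded_use)
  show "recursive_in (\<lambda>_. False) (\<lambda>n::nat. n)" by (rule recin_id)
  let ?R = "\<lambda>n t. \<exists>j\<le>n. 2 ^ (k * j) \<le> n \<and> n < 2 * 2 ^ (k * j) \<and> (\<forall>i<k * j. bit (t::nat) i = bit n i)"
  show "recursive_in (\<lambda>_. False) (\<lambda>e. ?R (fst e) (snd e))" by (intro recin_intros)
  fix n t :: nat assume t: "\<And>i. i < n \<Longrightarrow> bit t i = x i"
  have "(\<forall>i<k * j. x i = bit n i) \<longleftrightarrow> (\<forall>i<k * j. bit t i = bit n i)" if "2 ^ (k * j) \<le> n" for j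
  proof -
    have "k * j < n" using that less_exp[of "k * j"] by linarith
    then show ?thesis using t by (metis less_trans)
  qed
  then show "n \<in> prefix_set k x \<longleftrightarrow> ?R n t" unfolding mem_prefix_set[OF assms] by blast
qed

text \<open>For \<open>m = k * Suc n\<close>, exactly one element of the set is at least
  \<open>2 ^ m\<close> and less than \<open>2 * 2 ^ m\<close>. It codes the prefix of length
  \<open>m\<close>, from which the value at \<open>n < m\<close> is read off.\<close>

lemma tt_reducible_to_prefix_set:
  assumes "0 < k" shows "x \<le>\<^sub>t\<^sub>t (\<lambda>n. n \<in> prefix_set k x)"
proof (rule tt_reducible_if_bounded_use)
  show "recursive_in (\<lambda>_. False) (\<lambda>n. 2 * 2 ^ (k * Suc n) :: nat)" by (intro recin_intros)
  let ?R = "\<lambda>n t. \<exists>u<2 ^ (k * Suc n). bit (u::nat) n \<and> bit (t::nat) (2 ^ (k * Suc n) + u)"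
  show "recursive_in (\<lambda>_. False) (\<lambda>e. ?R (fst e) (snd e))" by (intro recin_intros)
  fix n t :: nat assume t: "\<And>i. i < 2 * 2 ^ (k * Suc n) \<Longrightarrow> bit t i = (i \<in> prefix_set k x)"
  let ?m = "k * Suc n"
  have mem: "2 ^ ?m + u \<in> prefix_set k x \<longleftrightarrow> u = prefix_val x ?m" if "u < 2 ^ ?m" for u
  proof
    assume "2 ^ ?m + u \<in> prefix_set k x"
    then obtain j where "2 ^ ?m + u = 2 ^ (k * j) + prefix_val x (k * j)" by (auto simp: prefix_set_def)
    \<comment> \<open>Once both numbers are written as vertices, their equality forces equal
      depths.\<close>
    moreover have "vertex k u (Suc n) = 2 ^ ?m + u"
      unfolding vertex_def using that by (simp only: take_bit_nat_eq_self)
    ultimately have "vertex k u (Suc n) = vertex k (prefix_val x (k * j)) j"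
      by (simp only: vertex_prefix_val[OF order_refl])
    then have "Suc n = j" unfolding vertex_eq_iff[OF assms] by blast
    then show "u = prefix_val x ?m"
      using \<open>2 ^ ?m + u = 2 ^ (k * j) + prefix_val x (k * j)\<close> by simp
  next
    assume "u = prefix_val x ?m"
    then show "2 ^ ?m + u \<in> prefix_set k x" unfolding prefix_set_def by blast
  qed
  have "n < ?m" using assms by (cases k) auto
  then have "x n \<longleftrightarrow> bit (prefix_val x ?m) n" by (simp only: bit_prefix_val simp_thms)
  also have "\<dots> \<longleftrightarrow> (\<exists>u<2 ^ ?m. bit u n \<and> 2 ^ ?m + u \<in> prefix_set k x)"
    using mem prefix_val_less[of x ?m] by blast
  also have "\<dots> \<longleftrightarrow> ?R n t"
  proof (intro ex_cong1 conj_cong refl)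
    fix u :: nat assume "u < 2 ^ ?m"
    then show "2 ^ ?m + u \<in> prefix_set k x \<longleftrightarrow> bit t (2 ^ ?m + u)"
      using t[of "2 ^ ?m + u"] by linarith
  qed
  finally show "x n \<longleftrightarrow> ?R n t" .
qed

section \<open>Positive effective dimension\<close>

lemma gamma_random_zero: "gamma_random 0 x"
  unfolding gamma_random_def
proof (intro allI impI notI)
  fix U assume U: "ml_test 0 U" and "x \<in> (\<Inter>n. open_of (U n))"
  then obtain w where w: "w \<in> U 1" unfolding open_of_def by blast
  \<comment> \<open>For exponent \<open>0\<close> a single string already has weight
    \<open>1\<close>, more than the \<open>1/2\<close> allowed at index \<open>1\<close>.\<close>
  have "ennreal 1 = (\<Sum>\<^sub>\<infinity>w\<in>{w}. ennreal (2 powr (- (real (length w) * 0))))" by simp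
  also have "\<dots> \<le> wt 0 (U 1)"
    unfolding wt_def using w by (intro infsum_mono_neutral nonneg_summable_on_complete) auto
  also have "\<dots> \<le> ennreal (1 / 2 ^ 1)" using U unfolding ml_test_def by blast
  finally show False by (subst (asm) ennreal_le_iff) auto
qed

text \<open>Randomness for exponent \<open>0\<close> makes the set under the supremum nonempty, so a
  positive supremum is witnessed by a positive member.\<close>

lemma effective_dim_pos:
  assumes "effective_dim x > 0"
  obtains \<gamma> where "0 < \<gamma>" "gamma_random \<gamma> x"
proof -
  let ?S = "{\<gamma>. 0 \<le> \<gamma> \<and> \<gamma> \<le> 1 \<and> gamma_random \<gamma> x}"
  have "0 \<in> ?S" using gamma_random_zero by simp
  then obtain \<gamma> where "\<gamma> \<in> ?S" "0 < \<gamma>"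
    using less_cSupD[of ?S 0] assms unfolding effective_dim_def by blast
  then show thesis using that by blast
qed

theorem theorem3p7:
  fixes x :: "nat \<Rightarrow> bool"
  assumes "effective_dim x > 0"
  shows "(\<exists>R Y :: nat set. ml_random (\<lambda>n. n \<in> R) \<and> infinite Y \<and> Y \<subseteq> R \<and> (\<lambda>n. n \<in> Y) \<le>\<^sub>T x) \<and>
         (\<exists>R Y :: nat set. ml_random (\<lambda>n. n \<in> R) \<and> infinite Y \<and> Y \<subseteq> R \<and> x \<equiv>\<^sub>t\<^sub>t (\<lambda>n. n \<in> Y))"
proof -
  obtain \<gamma> where \<gamma>: "0 < \<gamma>" "gamma_random \<gamma> x" by (rule effective_dim_pos[OF assms])
  obtain k :: nat where "3 < real k * \<gamma>" using reals_Archimedean3[OF \<gamma>(1)] by blast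
  moreover from this have k: "0 < k" by (cases k) auto
  ultimately obtain R where "ml_random (\<lambda>n. n \<in> R)" "prefix_set k x \<subseteq> R"
    using random_superset[OF \<gamma>(2) k] by auto
  moreover have "x \<equiv>\<^sub>t\<^sub>t (\<lambda>n. n \<in> prefix_set k x)"
    unfolding tt_equivalent_def using tt_reducible_prefix_set[OF k] tt_reducible_to_prefix_set[OF k] by blast
  ultimately show ?thesis
    using infinite_prefix_set[OF k] turing_reducible_prefix_set[OF k] by blast
qed

end
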